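(* Let $\varepsilon>0$ be arbitrary. Let $(x_n)_{n\ge1}$ be a sequence of distinct positive integers, and assume there exists $\eta>0$ such that $E_N=\mathcal{O}_\eta(N^{2+\eta})$ as $N\to\infty$. Then for Lebesgue-almost all $\alpha\in[0,1]$ we have $$V(N,S,\alpha)=NS+o(NS)$$ uniformly in the range $0\le S\le N^{-\eta-\varepsilon}$, as $N\to\infty$; that is, $\sup_{0<S\le N^{-\eta-\varepsilon}}\frac{|V(N,S,\alpha)-NS|}{NS}\to0$.
   Context: For a sequence of integers $(x_n)$, the additive energy of its truncation is $E_N=\#\{(n_1,n_2,n_3,n_4)\in\{1,\dots,N\}^4: x_{n_1}-x_{n_2}=x_{n_3}-x_{n_4}\}$. For $\alpha\in\mathbb{R}$, $0\le S\le1$, $y\in[0,1]$, let $S_N(S,y)=\sum_{n=1}^N\sum_{j\in\mathbb{Z}}\mathbf{1}_{[-S/2,S/2)}(\alpha x_n-y+j)$, and define the number variance $V(N,S,\alpha)=\int_0^1 S_N(S,y)^2\,dy-N^2S^2$. *)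

theory Defs
  imports "HOL-Analysis.Analysis" "HOL-Library.Landau_Symbols"
begin

definition additive_energy :: "(nat \<Rightarrow> int) \<Rightarrow> nat \<Rightarrow> nat" where
  "additive_energy x N =
     card {(n1, n2, n3, n4). n1 \<in> {1..N} \<and> n2 \<in> {1..N} \<and> n3 \<in> {1..N} \<and> n4 \<in> {1..N} \<and>
             x n1 - x n2 = x n3 - x n4}"

definition window_count :: "(nat \<Rightarrow> int) \<Rightarrow> real \<Rightarrow> nat \<Rightarrow> real \<Rightarrow> real \<Rightarrow> real" where
  "window_count x \<alpha> N S y =
     (\<Sum>n = 1..N. \<Sum>\<^sub>\<infinity>j\<in>(UNIV :: int set).
        indicat_real {- S / 2..<S / 2} (\<alpha> * of_int (x n) - y + of_int j))"

definition number_variance :: "(nat \<Rightarrow> int) \<Rightarrow> nat \<Rightarrow> real \<Rightarrow> real \<Rightarrow> real" where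
  "number_variance x N S \<alpha> =
     (LBINT y:{0..1}. (window_count x \<alpha> N S y)\<^sup>2) - (real N)\<^sup>2 * S\<^sup>2"

end

theory Submission
  imports Defs "HOL-Computational_Algebra.Primes" "HOL-Real_Asymp.Real_Asymp"
begin

text \<open>
  For irrational \<open>\<alpha>\<close>, unfolding the square gives
  \<open>V(N,S,\<alpha>) - NS = 2 \<integral>\<^sub>0\<^sup>S (R(N,s) - N\<^sup>2 s) ds\<close>, where \<open>R(N,s)\<close> counts, over pairs
  \<open>m < n \<le> N\<close> and both signs, the fractional parts of \<open>\<plusminus>\<alpha>(x\<^sub>m - x\<^sub>n)\<close> below \<open>s\<close>. Hence it is
  enough that almost surely \<open>R(N,s) - N\<^sup>2 s = o(N)\<close> uniformly for \<open>s\<close> up to \<open>N powr (-\<eta>-\<epsilon>)\<close>.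

  The covariance over \<open>\<alpha>\<close> of the counts attached to two differences \<open>d, e\<close> and a window of length
  \<open>l\<close> is at most \<open>4 l gcd(d,e) / max(d,e)\<close>. A GCD sum estimate, proved by raising the kernel to a
  high power and using the divisor bound, then bounds the variance by \<open>l N powr o(1)\<close> times the
  additive energy. Since this bound is additive in the window and superadditive over blocks of
  indices \<open>n\<close>, dyadic chaining in both \<open>N\<close> and \<open>s\<close> costs only powers of \<open>log N\<close>, and the saving
  \<open>N powr -\<epsilon>\<close> makes the resulting second moments summable along \<open>N = 2 ^ k\<close>.
\<close>

section \<open>The divisor bound and GCD sums\<close>

text \<open>The gaps \<open>x m - x n\<close> carry no size restriction, so the divisor bound cannot
  be applied to them directly. This is why the GCD form is truncated: \<open>gcd_kernel\<close> sees
  only pairs of gaps whose quotient in lowest terms has numerator and denominator at most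
  \<open>L\<close>, where \<open>L\<close> bounds the number of distinct gaps. After m compositions,
  divisors are counted only for integers up to \<open>L ^ m\<close>, so the loss is a small power of
  \<open>L\<close> whatever the size of the gaps. Pairs outside the truncation have weight at most
  \<open>1 / L\<close>, which Cauchy-Schwarz absorbs.

  The room for error is small. At windows of length \<open>N powr (-\<eta> - \<epsilon>)\<close> the
  variance is bounded by about \<open>N powr (2 - \<epsilon>)\<close>, while the deviation has to be
  o(N). A union bound over all N and a fine grid of windows would in general use up more than this
  saving. Chaining instead dominates the worst N up to \<open>2 ^ k\<close> and the worst window at
  once by a single nonnegative function of \<alpha>, so only one event per dyadic scale has to be
  controlled.\<close>

lemma card_divisors_prime_power_mult_le:
  fixes p m e :: nat
  assumes "prime p" "m > 0"
  shows "card {d. d dvd p ^ e * m} \<le> (e + 1) * card {d. d dvd m}"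
proof -
  have "{d. d dvd p ^ e * m} \<subseteq> (\<lambda>(i, d). p ^ i * d) ` ({..e} \<times> {d. d dvd m})"
  proof
    fix d assume "d \<in> {d. d dvd p ^ e * m}"
    then obtain b c where bc: "d = b * c" "b dvd p ^ e" "c dvd m"
      using division_decomp[of d "p ^ e" m] by auto
    then obtain i where "i \<le> e" "b = p ^ i"
      using divides_primepow_nat[OF \<open>prime p\<close>] by auto
    with bc show "d \<in> (\<lambda>(i, d). p ^ i * d) ` ({..e} \<times> {d. d dvd m})" by force
  qed
  moreover have "finite ({..e} \<times> {d. d dvd m})" using assms by simp
  ultimately have "card {d. d dvd p ^ e * m} \<le> card ({..e} \<times> {d. d dvd m})"
    by (meson card_image_le card_mono finite_imageI le_trans)
  then show ?thesis by (simp add: card_cartesian_product)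
qed

text \<open>The cost of one small prime in the divisor bound: \<open>p ^ e\<close> has
  \<open>e + 1\<close> divisors. The constant comes from \<open>1 + y \<le> exp y\<close> at
  \<open>y = \<theta> * e / 2\<close> together with \<open>1 / 2 \<le> ln 2\<close>.\<close>

lemma Suc_le_two_powr:
  fixes \<theta> :: real
  assumes "\<theta> > 0" "\<theta> \<le> 1"
  shows "real e + 1 \<le> 2 / \<theta> * 2 powr (\<theta> * real e)"
proof -
  have "1 + (\<theta> * real e / 2) \<le> exp (\<theta> * real e / 2)" by (rule exp_ge_add_one_self)
  also have "\<dots> \<le> exp (\<theta> * real e * ln 2)"
  proof -
    have "1/2 \<le> ln (2::real)" using ln2_ge_two_thirds by simp
    then have "\<theta> * real e * (1/2) \<le> \<theta> * real e * ln 2" using assms by (intro mult_left_mono) auto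
    then show ?thesis by simp
  qed
  also have "\<dots> = 2 powr (\<theta> * real e)" by (simp add: powr_def)
  finally have *: "1 + (\<theta> * real e / 2) \<le> 2 powr (\<theta> * real e)" .
  have "real e + 1 \<le> 2 / \<theta> * (1 + (\<theta> * real e / 2))"
    using assms by (simp add: field_simps)
  also have "\<dots> \<le> 2 / \<theta> * 2 powr (\<theta> * real e)"
    using * assms by (intro mult_left_mono) auto
  finally show ?thesis .
qed

text \<open>Induction that strips off the full power \<open>p ^ e\<close> of one prime. A prime with
  \<open>p powr \<theta> \<ge> 2\<close> is free, since
  \<open>e + 1 \<le> 2 ^ e \<le> p powr (\<theta> * e)\<close>; each smaller prime costs one factor
  \<open>2 / \<theta>\<close>.\<close>

lemma divisor_bound_prime_factors:
  fixes \<theta> :: real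
  assumes \<theta>: "\<theta> > 0" "\<theta> \<le> 1" and "n > 0"
  shows "real (card {d. d dvd n}) \<le>
    (2 / \<theta>) ^ card {p. prime p \<and> p dvd n \<and> real p < 2 powr (1 / \<theta>)} * real n powr \<theta>"
  using \<open>n > 0\<close>
proof (induction n rule: less_induct)
  case (less n)
  show ?case
  proof (cases "n = 1")
    case True
    have "{p::nat. prime p \<and> p dvd n \<and> real p < 2 powr (1 / \<theta>)} = {}"
      using True by auto
    then show ?thesis by (simp only: True card.empty) simp
  next
    case False
    then obtain p where p: "prime p" "p dvd n" using prime_factor_nat by blast
    define e where "e = multiplicity p n"
    obtain m where m: "n = p ^ e * m" "\<not> p dvd m"
      unfolding e_def using multiplicity_decompose'[of n p] p less.prems
      by (metis not_gr_zero not_prime_unit)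
    have e: "e \<ge> 1"
      using p less.prems by (metis One_nat_def Suc_leI e_def multiplicity_eq_zero_iff not_gr_zero not_prime_unit)
    have "m > 0" using m less.prems by (cases "m = 0") auto
    have "p ^ e > 1" using p e by (metis One_nat_def one_less_power prime_gt_1_nat less_le_trans zero_less_one)
    then have "m < n" using m \<open>m > 0\<close> by simp
    define Q where "Q = (\<lambda>n. {p. prime p \<and> p dvd n \<and> real p < 2 powr (1 / \<theta>)})"
    have fin: "finite (Q n)"
      unfolding Q_def by (rule finite_subset[of _ "{d. d dvd n}"]) (use less.prems in auto)
    have sub: "Q m \<subseteq> Q n" unfolding Q_def m by auto
    have IH: "real (card {d. d dvd m}) \<le> (2 / \<theta>) ^ card (Q m) * real m powr \<theta>"
      using less.IH[OF \<open>m < n\<close> \<open>m > 0\<close>] by (simp add: Q_def)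
    have c1: "2 / \<theta> \<ge> 1" using \<theta> by (simp add: field_simps)
    have split: "real n powr \<theta> = real p powr (\<theta> * real e) * real m powr \<theta>"
      unfolding m using p prime_gt_0_nat[of p]
      by (simp add: powr_mult powr_realpow[symmetric] powr_powr mult.commute)
    have key: "(real e + 1) * (2 / \<theta>) ^ card (Q m) \<le> (2 / \<theta>) ^ card (Q n) * real p powr (\<theta> * real e)"
    proof (cases "real p < 2 powr (1 / \<theta>)")
      case True
      then have "insert p (Q m) \<subseteq> Q n" "p \<notin> Q m"
        using sub p m unfolding Q_def by auto
      then have "card (Q m) + 1 \<le> card (Q n)"
        by (metis Suc_eq_plus1 card_insert_disjoint card_mono fin finite_subset sub)
      then have "(2 / \<theta>) ^ (card (Q m) + 1) \<le> (2 / \<theta>) ^ card (Q n)"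
        using c1 by (intro power_increasing) auto
      moreover have "(2::real) powr (\<theta> * real e) \<le> real p powr (\<theta> * real e)"
        using p \<theta> prime_ge_2_nat[of p] by (intro powr_mono2) auto
      moreover have "(real e + 1) * (2 / \<theta>) ^ card (Q m)
          \<le> (2 / \<theta> * 2 powr (\<theta> * real e)) * (2 / \<theta>) ^ card (Q m)"
        using Suc_le_two_powr[OF \<theta>, of e] \<theta> by (intro mult_right_mono) auto
      ultimately show ?thesis
        using \<theta> by (smt (verit, ccfv_SIG) Suc_eq_plus1 divide_pos_pos mult.commute mult.left_commute mult_mono power_Suc powr_ge_zero zero_le_power)
    next
      case False
      then have "(2 powr (1 / \<theta>)) powr (\<theta> * real e) \<le> real p powr (\<theta> * real e)"
        using \<theta> by (intro powr_mono2) auto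
      then have "2 ^ e \<le> real p powr (\<theta> * real e)"
        using \<theta> by (simp add: powr_powr powr_realpow)
      moreover have "real e + 1 \<le> 2 ^ e"
        by (metis Suc_eq_plus1 Suc_leI less_exp of_nat_Suc of_nat_le_iff of_nat_numeral of_nat_power add.commute)
      moreover have "(2 / \<theta>) ^ card (Q m) \<le> (2 / \<theta>) ^ card (Q n)"
        using c1 card_mono[OF fin sub] by (intro power_increasing) auto
      ultimately show ?thesis
        using \<theta> by (subst mult.commute, intro mult_mono) auto
    qed
    have "real (card {d. d dvd n}) \<le> real ((e + 1) * card {d. d dvd m})"
      unfolding of_nat_le_iff m(1) using p(1) \<open>m > 0\<close> by (rule card_divisors_prime_power_mult_le)
    also have "\<dots> = (real e + 1) * real (card {d. d dvd m})" by (simp add: algebra_simps)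
    also have "\<dots> \<le> (real e + 1) * ((2 / \<theta>) ^ card (Q m) * real m powr \<theta>)"
      using IH by (intro mult_left_mono) auto
    also have "\<dots> = ((real e + 1) * (2 / \<theta>) ^ card (Q m)) * real m powr \<theta>" by simp
    also have "\<dots> \<le> ((2 / \<theta>) ^ card (Q n) * real p powr (\<theta> * real e)) * real m powr \<theta>"
      by (intro mult_right_mono key) auto
    also have "\<dots> = (2 / \<theta>) ^ card (Q n) * real n powr \<theta>" using split by simp
    finally show ?thesis by (simp add: Q_def)
  qed
qed

lemma divisor_bound:
  fixes \<theta> :: real
  assumes "\<theta> > 0"
  obtains C where "C > 0" "\<And>n. n > 0 \<Longrightarrow> real (card {d. d dvd n}) \<le> C * real n powr \<theta>"
proof
  define t where "t = min \<theta> 1"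
  have t: "t > 0" "t \<le> 1" "t \<le> \<theta>" using assms by (auto simp: t_def)
  \<comment> \<open>The small primes dividing any n lie in this finite set, which makes the constant
    independent of n.\<close>
  define P where "P = {p::nat. real p < 2 powr (1 / t)}"
  have "P \<subseteq> {.. nat \<lceil>2 powr (1 / t)\<rceil>}"
    unfolding P_def by (auto simp: le_nat_iff) (smt (verit) le_of_int_ceiling of_int_le_iff of_int_of_nat_eq)
  then have fin: "finite P" using finite_subset by blast
  have c1: "2 / t \<ge> 1" using t by (simp add: field_simps)
  show "(2 / t) ^ card P > 0" using t by simp
  fix n :: nat assume "n > 0"
  have "real (card {d. d dvd n}) \<le> (2 / t) ^ card {p. prime p \<and> p dvd n \<and> real p < 2 powr (1 / t)} * real n powr t"
    using divisor_bound_prime_factors[OF t(1,2) \<open>n > 0\<close>] .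
  also have "\<dots> \<le> (2 / t) ^ card P * real n powr \<theta>"
    using c1 t \<open>n > 0\<close> by (intro mult_mono power_increasing card_mono fin powr_mono) (auto simp: P_def)
  finally show "real (card {d. d dvd n}) \<le> (2 / t) ^ card P * real n powr \<theta>" .
qed

text \<open>With \<open>g = gcd n a\<close> the summand is \<open>1 / b\<close> for
  \<open>b = a div g\<close>. The map from a to (g, b) is injective, with g a divisor of n and b at
  most L.\<close>

lemma sum_gcd_div_le:
  fixes n L :: nat
  assumes "n > 0"
  shows "(\<Sum>a=1..L. real (gcd n a) / real a) \<le> real (card {d. d dvd n}) * harm L"
proof -
  have fin: "finite {d. d dvd n}" using assms by simp
  have "(\<Sum>a=1..L. real (gcd n a) / real a) = (\<Sum>a=1..L. 1 / real (a div gcd n a))"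
    by (intro sum.cong) (auto simp: real_of_nat_div)
  also have "\<dots> = (\<Sum>(g, b)\<in>(\<lambda>a. (gcd n a, a div gcd n a)) ` {1..L}. 1 / real b)"
    by (subst sum.reindex) (auto simp: inj_on_def, metis dvd_mult_div_cancel gcd_dvd2)
  also have "\<dots> \<le> (\<Sum>(g, b)\<in>{d. d dvd n} \<times> {1..L}. 1 / real b)"
  proof (intro sum_mono2)
    show "(\<lambda>a. (gcd n a, a div gcd n a)) ` {1..L} \<subseteq> {d. d dvd n} \<times> {1..L}"
    proof (clarsimp)
      fix a assume a: "Suc 0 \<le> a" "a \<le> L"
      then have "a div gcd n a > 0" by (simp add: div_greater_zero_iff gcd_le2_nat)
      moreover have "a div gcd n a \<le> a" by simp
      ultimately show "Suc 0 \<le> a div gcd n a \<and> a div gcd n a \<le> L" using a by linarith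
    qed
  qed (use fin in auto)
  also have "\<dots> = real (card {d. d dvd n}) * harm L"
    by (simp add: sum.cartesian_product[symmetric] harm_def inverse_eq_divide)
  finally show ?thesis .
qed

section \<open>Composition and iteration of the truncated GCD kernel\<close>

lemma gcd_mult_dvd_gcd_mult_gcd: "gcd (x * y) z dvd gcd x z * gcd y (z::nat)"
proof -
  obtain b c where "gcd (x * y) z = b * c" "b dvd x" "c dvd y"
    using division_decomp[of "gcd (x * y) z" x y] by auto
  then show ?thesis
    by (metis dvd_mult_left dvd_mult_right gcd_dvd2 gcd_greatest mult_dvd_mono)
qed

text \<open>Compares the path from d through c to e with the direct step from d to e. Write
  \<open>a / b\<close> and \<open>d0 / e0\<close> for the reduced forms of \<open>d / c\<close> and
  \<open>d / e\<close>. Then \<open>gcd c e * a\<close> divides both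
  \<open>c * a = g * d0 * b\<close> and \<open>e * a = g * e0 * a\<close>, hence their gcd, and
  coprimality of a, b and of d0, e0 separates the two variables a and b.\<close>

lemma gcd_path_dvd:
  fixes c d e :: nat
  assumes "c > 0" "d > 0" "e > 0"
  shows "gcd c e * (d div gcd d c) dvd
    gcd d e * gcd (d div gcd d e) (d div gcd d c) * gcd (e div gcd d e) (c div gcd d c)"
proof -
  define h where "h = gcd d c"
  define g where "g = gcd d e"
  define a b d0 e0 where "a = d div h" and "b = c div h" and "d0 = d div g" and "e0 = e div g"
  have eqs: "d = h * a" "c = h * b" "d = g * d0" "e = g * e0"
    by (simp_all add: h_def g_def a_def b_def d0_def e0_def)
  have cop: "coprime a b" "coprime d0 e0"
    using assms by (simp_all add: a_def b_def d0_def e0_def h_def g_def div_gcd_coprime)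
  have "gcd c e * a dvd c * a" by simp
  also have "c * a = g * (d0 * b)" using eqs by (metis mult.assoc mult.commute)
  finally have 1: "gcd c e * a dvd g * (d0 * b)" .
  have "gcd c e * a dvd e * a" by simp
  also have "e * a = g * (e0 * a)" using eqs(4) by simp
  finally have "gcd c e * a dvd gcd (g * (d0 * b)) (g * (e0 * a))" using 1 by simp
  also have "\<dots> = g * gcd (d0 * b) (e0 * a)" by (simp add: gcd_mult_distrib_nat)
  also have "\<dots> dvd g * (gcd d0 a * gcd e0 b)"
  proof -
    have "gcd (d0 * b) (e0 * a) dvd gcd d0 (e0 * a) * gcd b (e0 * a)"
      by (rule gcd_mult_dvd_gcd_mult_gcd)
    also have "gcd d0 (e0 * a) = gcd d0 a" using cop by (simp add: gcd_mult_right_left_cancel)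
    also have "gcd b (e0 * a) = gcd e0 b" using cop by (simp add: gcd_mult_right_right_cancel coprime_commute gcd.commute)
    finally show ?thesis by simp
  qed
  finally show ?thesis by (simp add: a_def b_def d0_def e0_def h_def g_def mult.assoc)
qed

text \<open>For positive d, e the weight is \<open>1 / sqrt (a * b)\<close>, where
  \<open>a / b\<close> is \<open>d / e\<close> in lowest terms, and H bounds the height of this
  fraction. The symmetric normalisation by the square root, in place of the maximum, is the one
  under which composition of kernels is again controlled by such a kernel.\<close>

definition gcd_kernel :: "nat \<Rightarrow> nat \<Rightarrow> nat \<Rightarrow> real" where
  "gcd_kernel H d e =
     (if d div gcd d e \<le> H \<and> e div gcd d e \<le> H then real (gcd d e) / sqrt (real d * real e) else 0)"

lemma gcd_kernel_nonneg: "gcd_kernel H d e \<ge> 0"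
  by (simp add: gcd_kernel_def)

lemma gcd_kernel_commute: "gcd_kernel H d e = gcd_kernel H e d"
  by (simp add: gcd_kernel_def gcd.commute mult.commute conj_commute)

lemma gcd_le_sqrt:
  fixes d e :: nat
  assumes "d > 0" "e > 0"
  shows "real (gcd d e) \<le> sqrt (real d * real e)"
proof -
  have "gcd d e * gcd d e \<le> d * e" using assms by (intro mult_mono gcd_le1_nat gcd_le2_nat) auto
  then have "real (gcd d e) * real (gcd d e) \<le> real d * real e"
    by (metis of_nat_le_iff of_nat_mult)
  then show ?thesis by (intro real_le_rsqrt) (simp add: power2_eq_square)
qed

lemma gcd_kernel_le_1:
  assumes "d > 0" "e > 0"
  shows "gcd_kernel H d e \<le> 1"
  using gcd_le_sqrt[OF assms] assms by (auto simp: gcd_kernel_def divide_simps)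

text \<open>\<open>d / e\<close> is the product of \<open>d / c\<close> and \<open>c / e\<close>, so
  its reduced numerator divides the product of theirs. This makes heights at most multiply when
  kernels are composed.\<close>

lemma div_gcd_dvd_mult:
  fixes c d e :: nat
  assumes "c > 0" "d > 0" "e > 0"
  shows "d div gcd d e dvd (d div gcd d c) * (c div gcd c e)"
proof -
  define h where "h = gcd d c"
  define k where "k = gcd c e"
  define g where "g = gcd d e"
  define a b a' b' d0 e0 where "a = d div h" and "b = c div h" and "a' = c div k" and "b' = e div k"
    and "d0 = d div g" and "e0 = e div g"
  have eqs: "d = h * a" "c = h * b" "c = k * a'" "e = k * b'" "d = g * d0" "e = g * e0"
    by (simp_all add: h_def g_def k_def a_def b_def a'_def b'_def d0_def e0_def)
  have cop: "coprime d0 e0" using assms by (simp add: d0_def e0_def g_def div_gcd_coprime)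
  have "(g * c) * (d0 * (b * b')) = d * (c * (b * b'))" using eqs(5) by simp
  also have "\<dots> = d * b * (c * b')" by simp
  also have "d * b = c * a" using eqs(1,2) by simp
  also have "c * b' = a' * e" using eqs(3,4) by simp
  also have "c * a * (a' * e) = (g * c) * (e0 * (a * a'))" using eqs(6) by simp
  finally have "d0 * (b * b') = e0 * (a * a')"
    using assms by (simp add: g_def)
  then have "d0 dvd e0 * (a * a')" by (metis dvd_triv_left)
  then have "d0 dvd a * a'" using cop by (simp add: coprime_dvd_mult_right_iff)
  then show ?thesis by (simp add: d0_def a_def a'_def g_def h_def k_def)
qed

lemma inj_on_reduced_fraction:
  fixes d :: nat
  assumes "d > 0"
  shows "inj_on (\<lambda>c. (d div gcd d c, c div gcd d c)) {0<..}"
proof (rule inj_onI)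
  fix c c' :: nat
  assume c: "c \<in> {0<..}" "c' \<in> {0<..}"
    and eq: "(d div gcd d c, c div gcd d c) = (d div gcd d c', c' div gcd d c')"
  have "gcd d c * (d div gcd d c) = gcd d c' * (d div gcd d c')" by simp
  moreover have "d div gcd d c > 0" using assms by (simp add: div_greater_zero_iff gcd_le1_nat)
  ultimately have "gcd d c = gcd d c'" using eq by (metis mult_right_cancel not_gr_zero prod.inject)
  moreover have "c = gcd d c * (c div gcd d c)" "c' = gcd d c' * (c' div gcd d c')" by simp_all
  ultimately show "c = c'" using eq by (metis prod.inject)
qed

text \<open>The sum over \<open>c\<close> runs over the reduced fractions \<open>a / b\<close> of \<open>d / c\<close>, and
  the divisibility above splits it into the product of two sums over \<open>a\<close> and over \<open>b\<close>.\<close>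

lemma gcd_kernel_compose:
  fixes D :: "nat set" and K :: real
  assumes "finite D" "D \<subseteq> {0<..}" "d \<in> D" "e \<in> D"
    and K: "\<And>n. 0 < n \<Longrightarrow> n \<le> L * H \<Longrightarrow> real (card {t. t dvd n}) * harm L \<le> K" and "K \<ge> 0"
  shows "(\<Sum>c\<in>D. gcd_kernel L d c * gcd_kernel H c e) \<le> K\<^sup>2 * gcd_kernel (L * H) d e"
proof (cases "d div gcd d e \<le> L * H \<and> e div gcd d e \<le> L * H")
  \<comment> \<open>Heights at most multiply along d, c, e: if \<open>d / e\<close> has height above
    \<open>L * H\<close>, no c can satisfy both truncations and every term vanishes.\<close>
  case False
  have "gcd_kernel L d c * gcd_kernel H c e = 0" if "c \<in> D" for c
  proof (rule ccontr)
    assume "\<not> ?thesis"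
    then have le: "d div gcd d c \<le> L" "c div gcd d c \<le> L" "c div gcd c e \<le> H" "e div gcd c e \<le> H"
      by (auto simp: gcd_kernel_def split: if_splits)
    have pos: "c > 0" "d > 0" "e > 0" using assms that by auto
    have p: "d div gcd d c > 0" "c div gcd c e > 0" "e div gcd c e > 0" "c div gcd d c > 0"
      using pos by (simp_all add: div_greater_zero_iff gcd_le1_nat gcd_le2_nat)
    have "d div gcd d e \<le> (d div gcd d c) * (c div gcd c e)"
      using p by (intro dvd_imp_le div_gcd_dvd_mult pos) auto
    moreover have "e div gcd d e \<le> (e div gcd c e) * (c div gcd d c)"
      using div_gcd_dvd_mult[OF pos(1,3,2)] p by (intro dvd_imp_le) (auto simp: gcd.commute)
    ultimately show False using False le
      by (metis le_trans mult_le_mono mult.commute)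
  qed
  then have "(\<Sum>c\<in>D. gcd_kernel L d c * gcd_kernel H c e) = 0" by (intro sum.neutral) blast
  then show ?thesis by (simp add: gcd_kernel_nonneg)
next
  case True
  define g where "g = gcd d e"
  define d0 e0 where "d0 = d div g" and "e0 = e div g"
  define w where "w = real g / sqrt (real d * real e)"
  have pos: "d > 0" "e > 0" using assms by auto
  have pos0: "d0 > 0" "e0 > 0"
    using pos by (simp_all add: d0_def e0_def g_def div_greater_zero_iff gcd_le1_nat gcd_le2_nat)
  define F where "F = (\<lambda>(a, b). (real (gcd d0 a) / real a) * (real (gcd e0 b) / real b))"
  define \<rho> where "\<rho> = (\<lambda>c. (d div gcd d c, c div gcd d c))"
  define D' where "D' = {c\<in>D. \<rho> c \<in> {1..L} \<times> {1..L}}"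
  have term_le: "gcd_kernel L d c * gcd_kernel H c e \<le> (if c \<in> D' then w * F (\<rho> c) else 0)" if "c \<in> D" for c
  proof -
    have c: "c > 0" using assms that by auto
    have p: "d div gcd d c > 0" "c div gcd d c > 0"
      using pos c by (simp_all add: div_greater_zero_iff gcd_le1_nat gcd_le2_nat)
    show ?thesis
    proof (cases "c \<in> D'")
      case True
      define a b h where "a = d div gcd d c" and "b = c div gcd d c" and "h = gcd d c"
      have ab: "a > 0" "b > 0" using p by (auto simp: a_def b_def)
      have hb: "c = h * b" by (simp add: h_def b_def)
      have "h > 0" using pos by (simp add: h_def)
      have "gcd c e * a dvd g * gcd d0 a * gcd e0 b"
        using gcd_path_dvd[OF c pos] by (simp add: a_def b_def d0_def e0_def g_def)
      then have "gcd c e * a \<le> g * gcd d0 a * gcd e0 b"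
        using pos pos0 by (intro dvd_imp_le) (auto simp: g_def)
      then have le: "real (gcd c e) * real a \<le> real g * real (gcd d0 a) * real (gcd e0 b)"
        by (metis of_nat_le_iff of_nat_mult)
      \<comment> \<open>Since \<open>c = h * b\<close>, the factor h cancels and leaves
        \<open>gcd c e / (sqrt (d * e) * b)\<close>; the divisibility then replaces
        \<open>gcd c e\<close> by the direct weight times a function of a and a function of
        b.\<close>
      have "gcd_kernel L d c * gcd_kernel H c e
          \<le> (real h / sqrt (real d * real c)) * (real (gcd c e) / sqrt (real c * real e))"
        by (intro mult_mono) (auto simp: gcd_kernel_def h_def)
      also have "\<dots> = real h * real (gcd c e) / (sqrt (real d * real e) * real c)"
        using c by (simp add: real_sqrt_mult)
      also have "\<dots> = real (gcd c e) / (sqrt (real d * real e) * real b)"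
        using \<open>h > 0\<close> by (simp add: hb)
      also have "\<dots> \<le> w * F (a, b)"
        using le ab pos by (simp add: w_def F_def divide_simps)
      finally show ?thesis using True by (simp add: \<rho>_def a_def b_def)
    next
      case False
      then have "\<not> (d div gcd d c \<le> L \<and> c div gcd d c \<le> L)"
        using that p by (auto simp: D'_def \<rho>_def)
      then show ?thesis using False by (auto simp: gcd_kernel_def)
    qed
  qed
  have w0: "w \<ge> 0" by (simp add: w_def)
  have \<Phi>: "(\<Sum>a=1..L. real (gcd n a) / real a) \<le> K" if "0 < n" "n \<le> L * H" for n
    using sum_gcd_div_le[OF that(1), of L] K[OF that] by linarith
  have "(\<Sum>c\<in>D. gcd_kernel L d c * gcd_kernel H c e) \<le> (\<Sum>c\<in>D. if c \<in> D' then w * F (\<rho> c) else 0)"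
    by (intro sum_mono term_le)
  also have "\<dots> = (\<Sum>c\<in>D'. w * F (\<rho> c))"
    using assms(1) by (auto simp: sum.If_cases D'_def intro!: sum.cong)
  also have "\<dots> = w * (\<Sum>q\<in>\<rho> ` D'. F q)"
  proof -
    have "inj_on \<rho> D'" unfolding \<rho>_def
      by (rule inj_on_subset[OF inj_on_reduced_fraction[OF pos(1)]]) (use assms in \<open>auto simp: D'_def\<close>)
    then show ?thesis by (simp add: sum.reindex sum_distrib_left)
  qed
  also have "\<dots> \<le> w * (\<Sum>q\<in>{1..L} \<times> {1..L}. F q)"
    by (intro mult_left_mono sum_mono2 w0) (auto simp: D'_def F_def)
  also have "(\<Sum>q\<in>{1..L} \<times> {1..L}. F q) =
      (\<Sum>a=1..L. real (gcd d0 a) / real a) * (\<Sum>b=1..L. real (gcd e0 b) / real b)"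
    unfolding F_def sum.cartesian_product[symmetric] sum_product by simp
  also have "w * \<dots> \<le> w * (K * K)"
    using True pos0 \<open>K \<ge> 0\<close>
    by (intro mult_left_mono mult_mono \<Phi> w0) (auto simp: d0_def e0_def g_def sum_nonneg)
  finally show ?thesis using True by (simp add: gcd_kernel_def w_def g_def power2_eq_square mult_ac)
qed

fun kernel_iter :: "'a set \<Rightarrow> ('a \<Rightarrow> 'a \<Rightarrow> real) \<Rightarrow> ('a \<Rightarrow> real) \<Rightarrow> nat \<Rightarrow> 'a \<Rightarrow> real" where
  "kernel_iter D B r 0 d = r d"
| "kernel_iter D B r (Suc m) d = (\<Sum>e\<in>D. B d e * kernel_iter D B r m e)"

text \<open>Self-adjointness of the matrix B on D: one factor at a time moves across the inner
  product.\<close>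

lemma kernel_iter_inner:
  assumes sym: "\<And>d e. B d e = B e d"
  shows "(\<Sum>d\<in>D. kernel_iter D B r i d * kernel_iter D B r j d) = (\<Sum>d\<in>D. r d * kernel_iter D B r (i + j) d)"
proof (induction i arbitrary: j)
  case (Suc i)
  have "(\<Sum>d\<in>D. kernel_iter D B r (Suc i) d * kernel_iter D B r j d)
      = (\<Sum>d\<in>D. \<Sum>e\<in>D. B d e * kernel_iter D B r i e * kernel_iter D B r j d)"
    by (simp add: sum_distrib_right)
  also have "\<dots> = (\<Sum>e\<in>D. \<Sum>d\<in>D. B d e * kernel_iter D B r i e * kernel_iter D B r j d)"
    by (rule sum.swap)
  also have "\<dots> = (\<Sum>e\<in>D. kernel_iter D B r i e * kernel_iter D B r (Suc j) e)"
    by (simp add: sum_distrib_left sym mult_ac)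
  finally show ?case using Suc.IH[of "Suc j"] by simp
qed simp

text \<open>An elementary substitute for a spectral norm estimate. With \<open>a m\<close> the form
  of the m-th power of B at r and q the squared norm of r, Cauchy-Schwarz gives
  \<open>(a m)\<^sup>2 \<le> q * a (2 * m)\<close>. Each doubling of m squares the previous
  inequality and adds one factor q, whence the exponent \<open>2 ^ j - 1\<close>.\<close>

lemma kernel_iter_power_le:
  fixes B :: "'a \<Rightarrow> 'a \<Rightarrow> real"
  assumes sym: "\<And>d e. B d e = B e d" and nn: "\<And>d e. B d e \<ge> 0" "\<And>d. r d \<ge> 0"
  shows "(\<Sum>d\<in>D. r d * kernel_iter D B r 1 d) ^ (2 ^ j)
    \<le> (\<Sum>d\<in>D. (r d)\<^sup>2) ^ (2 ^ j - 1) * (\<Sum>d\<in>D. r d * kernel_iter D B r (2 ^ j) d)"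
proof (induction j)
  case (Suc j)
  let ?v = "kernel_iter D B r"
  define a where "a = (\<lambda>m. \<Sum>d\<in>D. r d * ?v m d)"
  define q where "q = (\<Sum>d\<in>D. (r d)\<^sup>2)"
  have v: "?v m d \<ge> 0" for m d
    by (induction m arbitrary: d) (auto intro!: sum_nonneg mult_nonneg_nonneg nn)
  have a0: "a m \<ge> 0" for m unfolding a_def by (intro sum_nonneg mult_nonneg_nonneg nn v)
  have q0: "q \<ge> 0" by (auto simp: q_def intro: sum_nonneg)
  have cs: "(a m)\<^sup>2 \<le> q * a (2 * m)" for m
  proof -
    have "(a m)\<^sup>2 \<le> q * (\<Sum>d\<in>D. (?v m d)\<^sup>2)" unfolding a_def q_def by (rule Cauchy_Schwarz_ineq_sum)
    also have "(\<Sum>d\<in>D. (?v m d)\<^sup>2) = a (2 * m)"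
      using kernel_iter_inner[of B D r m m, OF sym] by (simp add: a_def power2_eq_square mult_2)
    finally show ?thesis .
  qed
  have e: "2 ^ Suc j - 1 = Suc (2 * (2 ^ j - 1))"
    using one_le_power[of "2::nat" j] unfolding power_Suc by linarith
  have "a 1 ^ (2 ^ Suc j) = (a 1 ^ (2 ^ j))\<^sup>2" by (simp add: power_mult[symmetric] mult.commute)
  also have "\<dots> \<le> (q ^ (2 ^ j - 1) * a (2 ^ j))\<^sup>2"
    using Suc.IH a0[of 1] by (intro power_mono zero_le_power) (simp_all only: a_def q_def)
  also have "\<dots> = q ^ (2 * (2 ^ j - 1)) * (a (2 ^ j))\<^sup>2"
    by (simp add: power_mult_distrib power_mult[symmetric] mult.commute)
  also have "\<dots> \<le> q ^ (2 * (2 ^ j - 1)) * (q * a (2 * 2 ^ j))"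
    by (intro mult_left_mono cs) (use q0 in auto)
  also have "\<dots> = q ^ (2 ^ Suc j - 1) * a (2 ^ Suc j)"
    unfolding e by simp
  finally show ?case by (simp only: a_def q_def)
qed simp

text \<open>Each further application of the kernel costs a factor \<open>K\<^sup>2\<close> and
  multiplies the height bound by L. The induction starts at height 1, where the kernel has diagonal
  entries 1. One K serves all stages because no height exceeds \<open>L ^ m\<close>.\<close>

lemma kernel_iter_gcd_kernel_le:
  fixes D :: "nat set" and K :: real
  assumes "finite D" "D \<subseteq> {0<..}" and r: "\<And>d. r d \<ge> 0" and "K \<ge> 0" "L \<ge> 1"
    and K: "\<And>n. 0 < n \<Longrightarrow> n \<le> L ^ m \<Longrightarrow> real (card {t. t dvd n}) * harm L \<le> K"
    and "i \<le> m" "d \<in> D"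
  shows "kernel_iter D (gcd_kernel L) r i d \<le> (K\<^sup>2) ^ i * (\<Sum>e\<in>D. gcd_kernel (L ^ i) d e * r e)"
  using \<open>i \<le> m\<close> \<open>d \<in> D\<close>
proof (induction i arbitrary: d)
  case 0
  have "d > 0" using 0 assms by auto
  then have "r d = gcd_kernel 1 d d * r d" by (simp add: gcd_kernel_def)
  also have "\<dots> \<le> (\<Sum>e\<in>D. gcd_kernel 1 d e * r e)"
    using 0 assms(1) by (intro member_le_sum) (auto simp: gcd_kernel_nonneg r)
  finally show ?case by simp
next
  case (Suc i)
  have le: "L * L ^ i \<le> L ^ m"
    using Suc.prems \<open>L \<ge> 1\<close> power_increasing[of "Suc i" m L] by simp
  have "kernel_iter D (gcd_kernel L) r (Suc i) d
      \<le> (\<Sum>c\<in>D. gcd_kernel L d c * ((K\<^sup>2) ^ i * (\<Sum>e\<in>D. gcd_kernel (L ^ i) c e * r e)))"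
    using Suc by (auto intro!: sum_mono mult_left_mono gcd_kernel_nonneg)
  also have "\<dots> = (K\<^sup>2) ^ i * (\<Sum>c\<in>D. \<Sum>e\<in>D. gcd_kernel L d c * gcd_kernel (L ^ i) c e * r e)"
    by (simp add: sum_distrib_left mult_ac)
  also have "(\<Sum>c\<in>D. \<Sum>e\<in>D. gcd_kernel L d c * gcd_kernel (L ^ i) c e * r e)
      = (\<Sum>e\<in>D. (\<Sum>c\<in>D. gcd_kernel L d c * gcd_kernel (L ^ i) c e) * r e)"
    by (subst sum.swap) (simp add: sum_distrib_right)
  also have "(K\<^sup>2) ^ i * \<dots> \<le> (K\<^sup>2) ^ i * (\<Sum>e\<in>D. (K\<^sup>2 * gcd_kernel (L * L ^ i) d e) * r e)"
    using assms(1,2) Suc.prems le \<open>K \<ge> 0\<close>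
    by (intro mult_left_mono sum_mono mult_right_mono gcd_kernel_compose r K) auto
  also have "\<dots> = (K\<^sup>2) ^ Suc i * (\<Sum>e\<in>D. gcd_kernel (L ^ Suc i) d e * r e)"
    by (simp add: sum_distrib_left mult_ac)
  finally show ?case .
qed

section \<open>GCD sums with a bound independent of the size of the integers\<close>

lemma harm_le_powr:
  fixes a :: real
  assumes "a > 0" "L \<ge> 1"
  shows "harm L \<le> (1 + 1 / a) * real L powr a"
proof -
  have "harm L \<le> ln (real L) + 1" using euler_mascheroni_sequence_decreasing[of 1 L] assms by (simp add: harm_def)
  also have "ln (real L) \<le> real L powr a / a" using assms by (intro ln_powr_bound) auto
  also have "1 \<le> real L powr a" using assms by (intro ge_one_powr_ge_zero) auto
  finally show ?thesis by (simp add: algebra_simps)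
qed

text \<open>Taking a high power of the kernel reduces the loss of the trivial bound
  \<open>(\<Sum>r)\<^sup>2 \<le> L * \<Sum>r\<^sup>2\<close> to the factor \<open>L powr (1 / m)\<close>.\<close>

lemma gcd_kernel_form_bound:
  fixes \<tau> :: real
  assumes "\<tau> > 0"
  obtains C where "C > 0"
    "\<And>D L r. finite D \<Longrightarrow> D \<subseteq> {0<..} \<Longrightarrow> card D \<le> L \<Longrightarrow> L \<ge> 1 \<Longrightarrow> (\<And>d. r d \<ge> 0) \<Longrightarrow>
      (\<Sum>d\<in>D. \<Sum>e\<in>D. gcd_kernel L d e * r d * r e) \<le> C * real L powr \<tau> * (\<Sum>d\<in>D. (r d)\<^sup>2)"
proof -
  \<comment> \<open>The exponent \<tau> is shared out: the m-th root of L is at most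
    \<open>L powr (\<tau> / 2)\<close> because \<open>m \<ge> 2 / \<tau>\<close>. The choice of
    \<theta> gives \<open>(L ^ m) powr \<theta> = L powr (\<tau> / 8)\<close>, and with another
    \<open>\<tau> / 8\<close> for the harmonic sum K grows like \<open>L powr (\<tau> / 4)\<close>,
    so \<open>K\<^sup>2\<close> takes the other half.\<close>
  obtain j :: nat where j: "2 / \<tau> < 2 ^ j" using real_arch_pow[of 2 "2 / \<tau>"] by auto
  define m :: nat where "m = 2 ^ j"
  have m: "real m \<ge> 2 / \<tau>" "m > 0" using j by (auto simp: m_def)
  define \<theta> where "\<theta> = \<tau> / (8 * real m)"
  have \<theta>: "\<theta> > 0" using assms m by (simp add: \<theta>_def)
  obtain C1 where C1: "C1 > 0" "\<And>n. n > 0 \<Longrightarrow> real (card {d. d dvd n}) \<le> C1 * real n powr \<theta>"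
    using divisor_bound[OF \<theta>] by blast
  define C2 where "C2 = C1 * (1 + 1 / (\<tau> / 8))"
  have C2: "C2 > 0" unfolding C2_def using C1 assms by (intro mult_pos_pos add_pos_pos) auto
  show thesis
  proof (rule that[of "C2\<^sup>2"])
    show "C2\<^sup>2 > 0" using C2 by simp
  next
    fix D :: "nat set" and L :: nat and r :: "nat \<Rightarrow> real"
    assume D: "finite D" "D \<subseteq> {0<..}" "card D \<le> L" "L \<ge> 1" and r: "\<And>d. r d \<ge> 0"
    define K where "K = C2 * real L powr (\<tau> / 4)"
    have K0: "K \<ge> 0" using C2 by (simp add: K_def)
    have K: "real (card {t. t dvd n}) * harm L \<le> K" if n: "0 < n" "n \<le> L ^ m" for n
    proof -
      have "real n powr \<theta> \<le> real (L ^ m) powr \<theta>"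
        using n \<theta> by (intro powr_mono2) (auto simp del: of_nat_power)
      also have "\<dots> = real L powr (\<tau> / 8)"
        using D m by (simp add: powr_realpow[symmetric] powr_powr \<theta>_def)
      finally have "C1 * real n powr \<theta> \<le> C1 * real L powr (\<tau> / 8)" using C1 by (intro mult_left_mono) auto
      then have "real (card {t. t dvd n}) \<le> C1 * real L powr (\<tau> / 8)"
        using C1(2)[OF n(1)] by linarith
      then have "real (card {t. t dvd n}) * harm L
          \<le> (C1 * real L powr (\<tau> / 8)) * ((1 + 1 / (\<tau> / 8)) * real L powr (\<tau> / 8))"
        using C1 D assms by (intro mult_mono harm_le_powr) (auto simp: harm_nonneg)
      also have "\<dots> = C2 * (real L powr (\<tau> / 8) * real L powr (\<tau> / 8))" by (simp add: C2_def)
      also have "\<dots> = K" by (simp add: K_def flip: powr_add)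
      finally show ?thesis .
    qed
    let ?v = "kernel_iter D (gcd_kernel L) r"
    define q where "q = (\<Sum>d\<in>D. (r d)\<^sup>2)"
    have q0: "q \<ge> 0" by (auto simp: q_def intro: sum_nonneg)
    have sq: "(\<Sum>d\<in>D. r d)\<^sup>2 \<le> real L * q"
    proof -
      have "(\<Sum>d\<in>D. r d)\<^sup>2 \<le> real (card D) * q"
        using Cauchy_Schwarz_ineq_sum[of "\<lambda>_. 1" r D] by (simp add: q_def)
      also have "\<dots> \<le> real L * q" using D q0 by (intro mult_right_mono) auto
      finally show ?thesis .
    qed
    have "(\<Sum>d\<in>D. r d * ?v m d) \<le> (\<Sum>d\<in>D. r d * ((K\<^sup>2) ^ m * (\<Sum>e\<in>D. gcd_kernel (L ^ m) d e * r e)))"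
      by (intro sum_mono mult_left_mono kernel_iter_gcd_kernel_le[where m = m] D K K0 r) auto
    also have "\<dots> \<le> (\<Sum>d\<in>D. r d * ((K\<^sup>2) ^ m * (\<Sum>e\<in>D. 1 * r e)))"
      using D by (intro sum_mono mult_left_mono mult_right_mono gcd_kernel_le_1 r) auto
    also have "\<dots> = (K\<^sup>2) ^ m * (\<Sum>d\<in>D. r d)\<^sup>2"
      by (simp add: power2_eq_square sum_distrib_left sum_distrib_right mult_ac)
    also have "\<dots> \<le> (K\<^sup>2) ^ m * (real L * q)" using sq by (intro mult_left_mono) auto
    finally have am: "(\<Sum>d\<in>D. r d * ?v m d) \<le> (K\<^sup>2) ^ m * (real L * q)" .
    have "(\<Sum>d\<in>D. r d * ?v 1 d) ^ m \<le> q ^ (m - 1) * (\<Sum>d\<in>D. r d * ?v m d)"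
      using kernel_iter_power_le[of "gcd_kernel L" r D j] r gcd_kernel_commute gcd_kernel_nonneg
      by (simp add: m_def q_def)
    also have "\<dots> \<le> q ^ (m - 1) * ((K\<^sup>2) ^ m * (real L * q))"
      using am q0 by (intro mult_left_mono) auto
    also have "\<dots> = (K\<^sup>2) ^ m * real L * q ^ m"
      using m by (cases m) auto
    also have "\<dots> = (K\<^sup>2 * real L powr (1 / real m) * q) ^ m"
      using m D by (simp add: power_mult_distrib powr_realpow[symmetric] powr_powr)
    finally have "(\<Sum>d\<in>D. r d * ?v 1 d) \<le> K\<^sup>2 * real L powr (1 / real m) * q"
      using m q0 by (subst (asm) power_mono_iff) (auto intro!: sum_nonneg mult_nonneg_nonneg gcd_kernel_nonneg r)
    also have "\<dots> \<le> K\<^sup>2 * real L powr (\<tau> / 2) * q"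
      using m D q0 assms by (intro mult_right_mono mult_left_mono powr_mono) (auto simp: field_simps)
    also have "K\<^sup>2 * real L powr (\<tau> / 2) = C2\<^sup>2 * real L powr \<tau>"
      by (simp add: K_def power_mult_distrib power2_eq_square flip: powr_add)
    finally show "(\<Sum>d\<in>D. \<Sum>e\<in>D. gcd_kernel L d e * r d * r e) \<le> C2\<^sup>2 * real L powr \<tau> * (\<Sum>d\<in>D. (r d)\<^sup>2)"
      by (simp add: q_def sum_distrib_left mult_ac)
  qed
qed

text \<open>Within the truncation the maximum dominates the geometric mean; outside it
  \<open>L * gcd d e \<le> max d e\<close>. The additive \<open>1 / L\<close> is affordable on a set
  of at most L integers, where the squared sum of r is at most L times the sum of its
  squares.\<close>

lemma gcd_div_max_le:
  fixes d e L :: nat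
  assumes "d > 0" "e > 0" "L \<ge> 1"
  shows "real (gcd d e) / real (max d e) \<le> gcd_kernel L d e + 1 / real L"
proof (cases "d div gcd d e \<le> L \<and> e div gcd d e \<le> L")
  case True
  have "sqrt (real d * real e) \<le> real (max d e)"
    by (rule real_le_lsqrt) (auto simp: power2_eq_square intro!: mult_mono)
  then have "real (gcd d e) / real (max d e) \<le> real (gcd d e) / sqrt (real d * real e)"
    using assms by (intro divide_left_mono mult_pos_pos) auto
  then show ?thesis using True by (simp add: gcd_kernel_def add_increasing2)
next
  case False
  then have "L * gcd d e \<le> max d e"
    using assms by (metis dvd_div_mult_self gcd_dvd1 gcd_dvd2 le_max_iff_disj mult_le_mono1 nat_le_linear)
  then have "real L * real (gcd d e) \<le> real (max d e)" by (metis of_nat_le_iff of_nat_mult)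
  then have "real (gcd d e) / real (max d e) \<le> 1 / real L"
    using assms by (simp add: divide_simps mult.commute split: if_splits)
  then show ?thesis using gcd_kernel_nonneg[of L d e] by linarith
qed

lemma gcd_sum_bound:
  fixes \<tau> :: real
  assumes "\<tau> > 0"
  obtains C where "C > 0"
    "\<And>D L r. finite D \<Longrightarrow> D \<subseteq> {0<..} \<Longrightarrow> card D \<le> L \<Longrightarrow> L \<ge> 1 \<Longrightarrow> (\<And>d. r d \<ge> 0) \<Longrightarrow>
      (\<Sum>d\<in>D. \<Sum>e\<in>D. real (gcd d e) / real (max d e) * r d * r e)
        \<le> C * real L powr \<tau> * (\<Sum>d\<in>D. (r d)\<^sup>2)"
proof (rule gcd_kernel_form_bound[OF assms])
  fix C :: real assume C: "C > 0"
    "\<And>D L r. finite D \<Longrightarrow> D \<subseteq> {0<..} \<Longrightarrow> card D \<le> L \<Longrightarrow> L \<ge> 1 \<Longrightarrow> (\<And>d. r d \<ge> 0) \<Longrightarrow>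
      (\<Sum>d\<in>D. \<Sum>e\<in>D. gcd_kernel L d e * r d * r e) \<le> C * real L powr \<tau> * (\<Sum>d\<in>D. (r d)\<^sup>2)"
  show thesis
  proof (rule that[of "C + 1"])
    fix D :: "nat set" and L :: nat and r :: "nat \<Rightarrow> real"
    assume D: "finite D" "D \<subseteq> {0<..}" "card D \<le> L" "L \<ge> 1" and r: "\<And>d. r d \<ge> 0"
    define q where "q = (\<Sum>d\<in>D. (r d)\<^sup>2)"
    have q0: "q \<ge> 0" by (auto simp: q_def intro: sum_nonneg)
    have "(\<Sum>d\<in>D. r d)\<^sup>2 \<le> real (card D) * q"
      using Cauchy_Schwarz_ineq_sum[of "\<lambda>_. 1" r D] by (simp add: q_def)
    also have "\<dots> \<le> real L * q" using D q0 by (intro mult_right_mono) auto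
    finally have sq: "(\<Sum>d\<in>D. r d)\<^sup>2 / real L \<le> q" using D by (simp add: field_simps)
    have "1 \<le> real L powr \<tau>" using D assms by (intro ge_one_powr_ge_zero) auto
    then have one: "q \<le> real L powr \<tau> * q" using q0 by (simp add: mult_le_cancel_right1)
    have "(\<Sum>d\<in>D. \<Sum>e\<in>D. real (gcd d e) / real (max d e) * r d * r e)
        \<le> (\<Sum>d\<in>D. \<Sum>e\<in>D. (gcd_kernel L d e + 1 / real L) * r d * r e)"
      using D by (intro sum_mono mult_right_mono gcd_div_max_le r) auto
    also have "\<dots> = (\<Sum>d\<in>D. \<Sum>e\<in>D. gcd_kernel L d e * r d * r e) + (\<Sum>d\<in>D. r d)\<^sup>2 / real L"
      by (simp add: algebra_simps sum.distrib power2_eq_square sum_distrib_left sum_divide_distrib)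
    also have "\<dots> \<le> C * real L powr \<tau> * q + q"
      using C(2)[of D L r, OF D r] sq by (simp add: q_def)
    also have "\<dots> \<le> (C + 1) * real L powr \<tau> * q" using one by (simp add: algebra_simps)
    finally show "(\<Sum>d\<in>D. \<Sum>e\<in>D. real (gcd d e) / real (max d e) * r d * r e)
        \<le> (C + 1) * real L powr \<tau> * (\<Sum>d\<in>D. (r d)\<^sup>2)" by (simp add: q_def)
  qed (use C in auto)
qed

section \<open>Periodic integrals and covariances\<close>

text \<open>The half-open interval is a fundamental domain for translation by 1, and
  \<open>frac\<close> is the identity on it.\<close>

definition circle :: "real measure" where
  "circle = restrict_space lborel {0..<1}"

lemma space_circle [simp]: "space circle = {0..<1}"
  by (simp add: circle_def space_restrict_space)

lemma measurable_circle [measurable (raw)]: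
  "f \<in> borel_measurable borel \<Longrightarrow> f \<in> borel_measurable circle"
  unfolding circle_def by (intro measurable_restrict_space1) simp

lemma nn_integral_circle:
  "(\<integral>\<^sup>+\<alpha>. g \<alpha> \<partial>circle) = (\<integral>\<^sup>+\<alpha>. g \<alpha> * indicator {0..<1} \<alpha> \<partial>lborel)"
  unfolding circle_def by (rule nn_integral_restrict_space) simp

lemma emeasure_circle_space: "emeasure circle {0..<1} = 1"
  by (simp add: circle_def emeasure_restrict_space)

interpretation circle: finite_measure circle
  by standard (simp add: emeasure_circle_space)

lemma measure_circle [simp]: "measure circle {0..<1} = 1"
  using emeasure_circle_space by (simp add: measure_def)

lemma periodic_add_int:
  fixes g :: "real \<Rightarrow> 'a"
  assumes per: "\<And>x. g (x + 1) = g x"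
  shows "g (x + of_int k) = g x"
proof -
  have n: "g (y + of_nat n) = g y" for y n
  proof (induction n)
    case (Suc n)
    have "g (y + of_nat (Suc n)) = g ((y + of_nat n) + 1)" by (simp add: algebra_simps)
    then show ?case using Suc per by simp
  qed simp
  show ?thesis
  proof (cases "k \<ge> 0")
    case True
    then show ?thesis using n[of x "nat k"] by simp
  next
    case False
    then show ?thesis using n[of "x + of_int k" "nat (- k)"] by simp
  qed
qed

lemma nn_integral_interval_shift:
  fixes g :: "real \<Rightarrow> ennreal"
  assumes [measurable]: "g \<in> borel_measurable borel"
  shows "(\<integral>\<^sup>+x. g (x + t) * indicator {a..<b} x \<partial>lborel) = (\<integral>\<^sup>+x. g x * indicator {a + t..<b + t} x \<partial>lborel)"
proof -
  have "(\<integral>\<^sup>+x. g x * indicator {a + t..<b + t} x \<partial>lborel)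
      = (\<integral>\<^sup>+x. g (t + 1 * x) * indicator {a + t..<b + t} (t + 1 * x) \<partial>lborel)"
    by (subst nn_integral_real_affine[where c = 1 and t = t]) auto
  also have "\<dots> = (\<integral>\<^sup>+x. g (x + t) * indicator {a..<b} x \<partial>lborel)"
    by (intro nn_integral_cong) (auto simp: indicator_def add.commute)
  finally show ?thesis by simp
qed

lemma nn_integral_interval_split:
  fixes g :: "real \<Rightarrow> ennreal"
  assumes [measurable]: "g \<in> borel_measurable borel" and "a \<le> b" "b \<le> c"
  shows "(\<integral>\<^sup>+x. g x * indicator {a..<c} x \<partial>lborel) =
    (\<integral>\<^sup>+x. g x * indicator {a..<b} x \<partial>lborel) + (\<integral>\<^sup>+x. g x * indicator {b..<c} x \<partial>lborel)"
  using assms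
  by (subst nn_integral_add[symmetric]) (auto intro!: nn_integral_cong simp: indicator_def)

lemma nn_integral_circle_shift:
  fixes g :: "real \<Rightarrow> ennreal"
  assumes [measurable]: "g \<in> borel_measurable borel" and per: "\<And>x. g (x + 1) = g x"
  shows "(\<integral>\<^sup>+\<alpha>. g (\<alpha> + t) \<partial>circle) = (\<integral>\<^sup>+\<alpha>. g \<alpha> \<partial>circle)"
proof -
  define u where "u = frac t"
  have u: "0 \<le> u" "u \<le> 1" using frac_lt_1[of t] by (auto simp: u_def)
  have "g (\<alpha> + t) = g (\<alpha> + u)" for \<alpha>
    using periodic_add_int[of g "\<alpha> + u" "\<lfloor>t\<rfloor>", OF per] by (simp add: u_def frac_def)
  then have "(\<integral>\<^sup>+\<alpha>. g (\<alpha> + t) \<partial>circle) = (\<integral>\<^sup>+\<alpha>. g (\<alpha> + u) * indicator {0..<1} \<alpha> \<partial>lborel)"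
    by (simp add: nn_integral_circle)
  also have "\<dots> = (\<integral>\<^sup>+\<alpha>. g \<alpha> * indicator {u..<1 + u} \<alpha> \<partial>lborel)"
    by (subst nn_integral_interval_shift) auto
  also have "\<dots> = (\<integral>\<^sup>+\<alpha>. g \<alpha> * indicator {u..<1} \<alpha> \<partial>lborel) + (\<integral>\<^sup>+\<alpha>. g \<alpha> * indicator {1..<1 + u} \<alpha> \<partial>lborel)"
    using u by (intro nn_integral_interval_split) auto
  also have "(\<integral>\<^sup>+\<alpha>. g \<alpha> * indicator {1..<1 + u} \<alpha> \<partial>lborel) = (\<integral>\<^sup>+\<alpha>. g \<alpha> * indicator {0..<u} \<alpha> \<partial>lborel)"
    using nn_integral_interval_shift[of g 1 0 u] by (simp add: per add.commute)
  also have "(\<integral>\<^sup>+\<alpha>. g \<alpha> * indicator {u..<1} \<alpha> \<partial>lborel) + \<dots> = (\<integral>\<^sup>+\<alpha>. g \<alpha> * indicator {0..<1} \<alpha> \<partial>lborel)"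
    using u by (subst nn_integral_interval_split[of g 0 u 1]) (auto simp: add.commute)
  finally show ?thesis by (simp add: nn_integral_circle)
qed

text \<open>The substitution spreads one period over n consecutive periods, each with the same
  integral, and the Jacobian divides by n.\<close>

lemma nn_integral_circle_mult:
  fixes g :: "real \<Rightarrow> ennreal"
  assumes [measurable]: "g \<in> borel_measurable borel" and per: "\<And>x. g (x + 1) = g x" and "n > 0"
  shows "(\<integral>\<^sup>+\<alpha>. g (real n * \<alpha>) \<partial>circle) = (\<integral>\<^sup>+\<alpha>. g \<alpha> \<partial>circle)"
proof -
  have I: "(\<integral>\<^sup>+x. g x * indicator {0..<real m} x \<partial>lborel) = of_nat m * (\<integral>\<^sup>+\<alpha>. g \<alpha> \<partial>circle)" for m
  proof (induction m)
    case (Suc m)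
    have "(\<integral>\<^sup>+x. g x * indicator {0..<real (Suc m)} x \<partial>lborel) =
        (\<integral>\<^sup>+x. g x * indicator {0..<real m} x \<partial>lborel) + (\<integral>\<^sup>+x. g x * indicator {real m..<real (Suc m)} x \<partial>lborel)"
      by (intro nn_integral_interval_split) auto
    also have "(\<integral>\<^sup>+x. g x * indicator {real m..<real (Suc m)} x \<partial>lborel) = (\<integral>\<^sup>+\<alpha>. g \<alpha> \<partial>circle)"
      using nn_integral_interval_shift[of g "real m" 0 1] periodic_add_int[of g _ "int m", OF per]
      by (simp add: nn_integral_circle add.commute)
    finally show ?case by (simp add: Suc algebra_simps)
  qed (simp add: nn_integral_0_iff_AE)
  have "of_nat n * (\<integral>\<^sup>+\<alpha>. g \<alpha> \<partial>circle) = (\<integral>\<^sup>+x. g x * indicator {0..<real n} x \<partial>lborel)"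
    by (simp add: I)
  also have "\<dots> = ennreal \<bar>real n\<bar> * (\<integral>\<^sup>+x. g (0 + real n * x) * indicator {0..<real n} (0 + real n * x) \<partial>lborel)"
    using \<open>n > 0\<close> by (subst nn_integral_real_affine[where c = "real n" and t = 0]) auto
  also have "(\<integral>\<^sup>+x. g (0 + real n * x) * indicator {0..<real n} (0 + real n * x) \<partial>lborel) = (\<integral>\<^sup>+\<alpha>. g (real n * \<alpha>) \<partial>circle)"
    unfolding nn_integral_circle
    using \<open>n > 0\<close> by (intro nn_integral_cong) (auto simp: indicator_def zero_le_mult_iff)
  finally have "of_nat n * (\<integral>\<^sup>+\<alpha>. g \<alpha> \<partial>circle) = of_nat n * (\<integral>\<^sup>+\<alpha>. g (real n * \<alpha>) \<partial>circle)"
    by (simp add: ennreal_of_nat_eq_real_of_nat)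
  then show ?thesis using \<open>n > 0\<close> by (subst (asm) ennreal_mult_cancel_left) auto
qed

lemma nn_integral_circle_uminus:
  fixes g :: "real \<Rightarrow> ennreal"
  assumes [measurable]: "g \<in> borel_measurable borel" and per: "\<And>x. g (x + 1) = g x"
  shows "(\<integral>\<^sup>+\<alpha>. g (- \<alpha>) \<partial>circle) = (\<integral>\<^sup>+\<alpha>. g \<alpha> \<partial>circle)"
proof -
  have "(\<integral>\<^sup>+\<alpha>. g \<alpha> \<partial>circle) = (\<integral>\<^sup>+x. g x * indicator {-1..<0} x \<partial>lborel)"
    using nn_integral_interval_shift[of g 1 "-1" 0] by (simp add: per nn_integral_circle)
  \<comment> \<open>Reflection maps \<open>{0..<1}\<close> to the interval that is open on the left,
    so the two endpoints, a null set, have to be exchanged first.\<close>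
  also have "\<dots> = (\<integral>\<^sup>+x. g x * indicator {-1<..0} x \<partial>lborel)"
    by (intro nn_integral_cong_AE) (use AE_lborel_singleton[of "-1"] AE_lborel_singleton[of 0] in eventually_elim,
      auto simp: indicator_def)
  also have "\<dots> = ennreal \<bar>-1\<bar> * (\<integral>\<^sup>+x. g (0 + (-1) * x) * indicator {-1<..0} (0 + (-1) * x) \<partial>lborel)"
    by (subst nn_integral_real_affine[where c = "-1" and t = 0]) auto
  also have "\<dots> = (\<integral>\<^sup>+x. g (- x) * indicator {0..<1} x \<partial>lborel)"
    by (auto intro!: nn_integral_cong simp: indicator_def)
  finally show ?thesis by (simp add: nn_integral_circle)
qed

lemma integral_circle_cong_nn:
  fixes f g :: "real \<Rightarrow> real"
  assumes "(\<integral>\<^sup>+\<alpha>. ennreal (f \<alpha>) \<partial>circle) = (\<integral>\<^sup>+\<alpha>. ennreal (g \<alpha>) \<partial>circle)"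
    and "f \<in> borel_measurable borel" "g \<in> borel_measurable borel" "\<And>x. f x \<ge> 0" "\<And>x. g x \<ge> 0"
  shows "(\<integral>\<alpha>. f \<alpha> \<partial>circle) = (\<integral>\<alpha>. g \<alpha> \<partial>circle)"
  using assms by (simp add: integral_eq_nn_integral measurable_circle)

lemma integral_circle_shift:
  fixes g :: "real \<Rightarrow> real"
  assumes [measurable]: "g \<in> borel_measurable borel" and "\<And>x. g (x + 1) = g x" "\<And>x. g x \<ge> 0"
  shows "(\<integral>\<alpha>. g (\<alpha> + t) \<partial>circle) = (\<integral>\<alpha>. g \<alpha> \<partial>circle)"
  using assms by (intro integral_circle_cong_nn nn_integral_circle_shift[of "\<lambda>x. ennreal (g x)"]) auto

lemma integral_circle_mult:
  fixes g :: "real \<Rightarrow> real"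
  assumes [measurable]: "g \<in> borel_measurable borel" and "\<And>x. g (x + 1) = g x" "\<And>x. g x \<ge> 0" "n > 0"
  shows "(\<integral>\<alpha>. g (real n * \<alpha>) \<partial>circle) = (\<integral>\<alpha>. g \<alpha> \<partial>circle)"
  using assms by (intro integral_circle_cong_nn nn_integral_circle_mult[of "\<lambda>x. ennreal (g x)"]) auto

lemma integral_circle_uminus:
  fixes g :: "real \<Rightarrow> real"
  assumes [measurable]: "g \<in> borel_measurable borel" and "\<And>x. g (x + 1) = g x" "\<And>x. g x \<ge> 0"
  shows "(\<integral>\<alpha>. g (- \<alpha>) \<partial>circle) = (\<integral>\<alpha>. g \<alpha> \<partial>circle)"
  using assms by (intro integral_circle_cong_nn nn_integral_circle_uminus[of "\<lambda>x. ennreal (g x)"]) auto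

section \<open>Correlations of arc indicators under integer dilations\<close>

lemma borel_measurable_frac [measurable (raw)]:
  fixes f :: "'a \<Rightarrow> real"
  assumes [measurable]: "f \<in> borel_measurable M"
  shows "(\<lambda>x. frac (f x)) \<in> borel_measurable M"
  unfolding frac_def by measurable

text \<open>Both signs are counted because the ordered pairs \<open>(m, n)\<close> and \<open>(n, m)\<close> both enter the
  number variance; for \<open>a = 0\<close>, \<open>b \<le> 1/2\<close> and \<open>t \<notin> \<int>\<close> this is the indicator of
  \<open>t\<close> having distance less than \<open>b\<close> to the nearest integer.\<close>

definition sym_arc :: "real \<Rightarrow> real \<Rightarrow> real \<Rightarrow> real" where
  "sym_arc a b t = indicator {a..<b} (frac t) + indicator {a..<b} (frac (- t))"

lemma borel_measurable_sym_arc [measurable (raw)]: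
  assumes [measurable]: "f \<in> borel_measurable M"
  shows "(\<lambda>x. sym_arc a b (f x)) \<in> borel_measurable M"
  unfolding sym_arc_def by measurable

lemma sym_arc_nonneg: "sym_arc a b t \<ge> 0" and sym_arc_le_2: "sym_arc a b t \<le> 2"
  by (auto simp: sym_arc_def indicator_def)

lemma sym_arc_add_int: "sym_arc a b (t + of_int k) = sym_arc a b t"
proof -
  have "frac (- t - of_int k) = frac (- t)"
    using frac_add_of_int_right[of "- t" "- k"] by simp
  then show ?thesis by (simp add: sym_arc_def)
qed

lemma sym_arc_diff:
  assumes "a \<le> b" "b \<le> c"
  shows "sym_arc a c t - sym_arc a b t = sym_arc b c t"
  using assms by (auto simp: sym_arc_def indicator_def)

lemma integrable_circle_bounded:
  fixes f :: "real \<Rightarrow> real"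
  assumes "f \<in> borel_measurable borel" "\<And>x. \<bar>f x\<bar> \<le> B"
  shows "integrable circle f"
  using assms by (intro circle.integrable_const_bound[where B = B]) (auto intro: measurable_circle)

lemma integral_indicator_frac:
  assumes "0 \<le> a" "a \<le> b" "b \<le> 1"
  shows "(\<integral>\<alpha>. indicat_real {a..<b} (frac \<alpha>) \<partial>circle) = b - a"
proof -
  have "(\<integral>\<alpha>. indicat_real {a..<b} (frac \<alpha>) \<partial>circle) = (\<integral>\<alpha>. indicat_real {a..<b} \<alpha> \<partial>circle)"
    by (intro Bochner_Integration.integral_cong) auto
  also have "\<dots> = measure circle {a..<b}"
    using assms by (simp add: Int_absorb2 subset_eq)
  also have "\<dots> = b - a"
    using assms unfolding circle_def by (subst measure_restrict_space) auto
  finally show ?thesis .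
qed

lemma integral_sym_arc:
  assumes "0 \<le> a" "a \<le> b" "b \<le> 1" "n > 0"
  shows "(\<integral>\<alpha>. sym_arc a b (real n * \<alpha>) \<partial>circle) = 2 * (b - a)"
proof -
  have "(\<integral>\<alpha>. sym_arc a b (real n * \<alpha>) \<partial>circle) = (\<integral>\<alpha>. sym_arc a b \<alpha> \<partial>circle)"
    using assms sym_arc_add_int[of a b _ 1] by (intro integral_circle_mult) (auto simp: sym_arc_nonneg)
  also have "\<dots> = (\<integral>\<alpha>. indicat_real {a..<b} (frac \<alpha>) \<partial>circle) + (\<integral>\<alpha>. indicat_real {a..<b} (frac (- \<alpha>)) \<partial>circle)"
    unfolding sym_arc_def
    by (intro Bochner_Integration.integral_add integrable_circle_bounded[where B = 1]) (auto simp: indicator_def)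
  also have "(\<integral>\<alpha>. indicat_real {a..<b} (frac (- \<alpha>)) \<partial>circle) = (\<integral>\<alpha>. indicat_real {a..<b} (frac \<alpha>) \<partial>circle)"
    by (intro integral_circle_uminus) (auto simp: frac_1_eq)
  finally show ?thesis using integral_indicator_frac[OF assms(1-3)] by simp
qed

lemma card_int_interval_le:
  fixes x y :: real
  assumes "x \<le> y"
  shows "finite {i::int. x \<le> of_int i \<and> of_int i < y}"
    and "real (card {i::int. x \<le> of_int i \<and> of_int i < y}) \<le> y - x + 1"
proof -
  have eq: "{i::int. x \<le> of_int i \<and> of_int i < y} = {\<lceil>x\<rceil>..<\<lceil>y\<rceil>}"
    by (auto simp: ceiling_le_iff less_ceiling_iff)
  show "finite {i::int. x \<le> of_int i \<and> of_int i < y}" unfolding eq by simp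
  have "\<lceil>x\<rceil> \<le> \<lceil>y\<rceil>" using assms by (rule ceiling_mono)
  then have "real (card {\<lceil>x\<rceil>..<\<lceil>y\<rceil>}) = of_int \<lceil>y\<rceil> - of_int \<lceil>x\<rceil>" by simp
  also have "\<dots> \<le> y - x + 1" using ceiling_correct[of x] ceiling_correct[of y] by linarith
  finally show "real (card {i::int. x \<le> of_int i \<and> of_int i < y}) \<le> y - x + 1" unfolding eq .
qed

text \<open>By coprimality the n points are distinct modulo 1, and n times each of them is congruent
  to \<open>\<theta> = frac (n * t)\<close>. They are therefore spaced by multiples of
  \<open>1 / n\<close>, and an interval of length \<open>b - a\<close> holds at most
  \<open>n * (b - a) + 1\<close> of them.\<close>

lemma sum_indicator_frac_le:
  fixes c :: int and n :: nat
  assumes "n > 0" "coprime c (int n)" "a \<le> b"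
  shows "(\<Sum>k<n. indicat_real {a..<b} (frac (t + of_int c * real k / real n))) \<le> real n * (b - a) + 1"
proof -
  define f where "f = (\<lambda>k. frac (t + of_int c * real k / real n))"
  define \<theta> where "\<theta> = frac (real n * t)"
  have ex: "\<exists>i::int. real n * f k = \<theta> + of_int i" for k
  proof
    define z where "z = t + of_int c * real k / real n"
    have "real n * f k = real n * t + of_int c * real k - real n * of_int \<lfloor>z\<rfloor>"
      using \<open>n > 0\<close> by (simp add: f_def frac_def z_def algebra_simps)
    then show "real n * f k = \<theta> + of_int (\<lfloor>real n * t\<rfloor> + c * int k - int n * \<lfloor>z\<rfloor>)"
      by (simp add: \<theta>_def frac_def)
  qed
  define i where "i = (\<lambda>k. SOME i::int. real n * f k = \<theta> + of_int i)"
  have i: "real n * f k = \<theta> + of_int (i k)" for k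
    unfolding i_def by (rule someI_ex[OF ex])
  have inj: "inj_on i {..<n}"
  proof (rule inj_onI)
    fix k l assume kl: "k \<in> {..<n}" "l \<in> {..<n}" "i k = i l"
    then have "real n * f k = real n * f l" using i[of k] i[of l] by simp
    then have "f k = f l" using \<open>n > 0\<close> by simp
    then have "(t + of_int c * real k / real n) - (t + of_int c * real l / real n) \<in> \<int>"
      unfolding f_def by (metis frac_eqE add_diff_cancel_left' Ints_of_int)
    then obtain m :: int where "(t + of_int c * real k / real n) - (t + of_int c * real l / real n) = of_int m"
      by (auto elim: Ints_cases)
    then have "of_int c * (real k - real l) / real n = of_int m"
      by (simp add: algebra_simps diff_divide_distrib)
    then have "of_int c * (real k - real l) = of_int m * real n"
      using \<open>n > 0\<close> by (simp add: nonzero_divide_eq_eq)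
    then have "real_of_int (c * (int k - int l)) = real_of_int (m * int n)" by simp
    then have "c * (int k - int l) = m * int n" by (simp only: of_int_eq_iff)
    then have "int n dvd c * (int k - int l)" by simp
    then have "int n dvd int k - int l"
      using assms(2) by (simp add: coprime_dvd_mult_right_iff coprime_commute)
    then show "k = l" using kl(1,2)
      by (metis mod_eq_dvd_iff lessThan_iff mod_less of_nat_eq_iff zmod_int)
  qed
  define J where "J = {j::int. real n * a - \<theta> \<le> of_int j \<and> of_int j < real n * b - \<theta>}"
  have le: "real n * a - \<theta> \<le> real n * b - \<theta>" using assms by (simp add: mult_left_mono)
  have "(\<Sum>k<n. indicat_real {a..<b} (f k)) = real (card {k\<in>{..<n}. f k \<in> {a..<b}})"
    by (simp add: indicator_def sum.If_cases Int_def conj_commute)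
  also have "card {k\<in>{..<n}. f k \<in> {a..<b}} = card (i ` {k\<in>{..<n}. f k \<in> {a..<b}})"
    by (rule card_image[symmetric]) (rule inj_on_subset[OF inj], auto)
  also have "\<dots> \<le> card J"
  proof (rule card_mono)
    show "finite J" unfolding J_def by (rule card_int_interval_le[OF le])
    show "i ` {k\<in>{..<n}. f k \<in> {a..<b}} \<subseteq> J"
    proof clarsimp
      fix k assume k: "a \<le> f k" "f k < b"
      then have "real n * a \<le> real n * f k" "real n * f k < real n * b" using \<open>n > 0\<close> by simp_all
      then show "i k \<in> J" using i[of k] by (simp add: J_def)
    qed
  qed
  also have "real (card J) \<le> real n * (b - a) + 1"
    using card_int_interval_le(2)[OF le] by (simp add: J_def algebra_simps)
  finally show ?thesis by (simp add: f_def)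
qed

lemma sum_sym_arc_le:
  fixes d n :: nat
  assumes "n > 0" "coprime d n" "a \<le> b"
  shows "(\<Sum>k<n. sym_arc a b (t + real d * real k / real n)) \<le> 2 * (real n * (b - a) + 1)"
proof -
  have "(\<Sum>k<n. sym_arc a b (t + real d * real k / real n))
     = (\<Sum>k<n. indicat_real {a..<b} (frac (t + of_int (int d) * real k / real n)))
     + (\<Sum>k<n. indicat_real {a..<b} (frac (- t + of_int (- int d) * real k / real n)))"
    by (simp add: sym_arc_def sum.distrib algebra_simps)
  also have "\<dots> \<le> (real n * (b - a) + 1) + (real n * (b - a) + 1)"
    using assms by (intro add_mono sum_indicator_frac_le) auto
  finally show ?thesis by simp
qed

text \<open>The integral does not change under the shifts \<open>\<alpha> \<mapsto> \<alpha> + k / n\<close>. They fix the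
  second factor, and the average of the first one over them is close to its mean.\<close>

lemma integral_sym_arc_mult_coprime_le:
  fixes d n :: nat
  assumes "0 \<le> a" "a \<le> b" "b \<le> 1" "n > 0" "coprime d n"
  shows "(\<integral>\<alpha>. sym_arc a b (real d * \<alpha>) * sym_arc a b (real n * \<alpha>) \<partial>circle)
    \<le> 4 * (b - a)\<^sup>2 + 4 * (b - a) / real n"
proof -
  define h where "h = (\<lambda>\<alpha>. sym_arc a b (real d * \<alpha>) * sym_arc a b (real n * \<alpha>))"
  have [measurable]: "h \<in> borel_measurable borel" unfolding h_def by measurable
  have h0: "h x \<ge> 0" for x by (simp add: h_def sym_arc_nonneg)
  have h4: "\<bar>h x\<bar> \<le> 4" for x
    using mult_mono[OF sym_arc_le_2 sym_arc_le_2 _ sym_arc_nonneg, of a b "real d * x" a b "real n * x"] h0[of x]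
    by (simp add: h_def)
  have per: "h (x + 1) = h x" for x
    using sym_arc_add_int[of a b "real d * x" "int d"] sym_arc_add_int[of a b "real n * x" "int n"]
    by (simp add: h_def algebra_simps)
  have hk: "h (\<alpha> + real k / real n) = sym_arc a b (real d * \<alpha> + real d * real k / real n) * sym_arc a b (real n * \<alpha>)" for \<alpha> k
    using sym_arc_add_int[of a b "real n * \<alpha>" "int k"] \<open>n > 0\<close>
    by (simp add: h_def algebra_simps)
  have "real n * (\<integral>\<alpha>. h \<alpha> \<partial>circle) = (\<Sum>k<n. \<integral>\<alpha>. h (\<alpha> + real k / real n) \<partial>circle)"
    using per h0 by (subst integral_circle_shift) auto
  also have "\<dots> = (\<integral>\<alpha>. (\<Sum>k<n. h (\<alpha> + real k / real n)) \<partial>circle)"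
    by (intro Bochner_Integration.integral_sum[symmetric] integrable_circle_bounded[where B = 4] h4) measurable
  also have "\<dots> \<le> (\<integral>\<alpha>. 2 * (real n * (b - a) + 1) * sym_arc a b (real n * \<alpha>) \<partial>circle)"
  proof (intro integral_mono_AE integrable_circle_bounded AE_I2)
    fix x
    show "\<bar>\<Sum>k<n. h (x + real k / real n)\<bar> \<le> real n * 4"
      using sum_bounded_above[of "{..<n}" "\<lambda>k. \<bar>h (x + real k / real n)\<bar>" 4] h4
      by (intro order.trans[OF sum_abs]) auto
    show "\<bar>2 * (real n * (b - a) + 1) * sym_arc a b (real n * x)\<bar> \<le> 2 * (real n * (b - a) + 1) * 2"
      unfolding abs_mult using assms sym_arc_le_2[of a b "real n * x"] sym_arc_nonneg[of a b "real n * x"]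
      by (intro mult_mono) auto
    have "(\<Sum>k<n. h (x + real k / real n)) = (\<Sum>k<n. sym_arc a b (real d * x + real d * real k / real n)) * sym_arc a b (real n * x)"
      by (simp add: hk sum_distrib_right)
    also have "\<dots> \<le> 2 * (real n * (b - a) + 1) * sym_arc a b (real n * x)"
      using assms by (intro mult_right_mono sum_sym_arc_le sym_arc_nonneg) auto
    finally show "(\<Sum>k<n. h (x + real k / real n)) \<le> 2 * (real n * (b - a) + 1) * sym_arc a b (real n * x)" .
  qed measurable
  also have "\<dots> = 2 * (real n * (b - a) + 1) * (2 * (b - a))"
    using assms by (simp add: integral_sym_arc)
  finally show ?thesis using \<open>n > 0\<close> by (simp add: h_def field_simps power2_eq_square)
qed

text \<open>Dividing out the gcd leaves the integral unchanged and makes the frequencies coprime.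
  Averaging over shifts by the reciprocal of the larger reduced frequency gives the error
  \<open>1 / max d' e'\<close>, which is \<open>gcd d e / max d e\<close>.\<close>

lemma integral_sym_arc_mult_le:
  fixes d e :: nat
  assumes ab: "0 \<le> a" "a \<le> b" "b \<le> 1" and pos: "d > 0" "e > 0"
  shows "(\<integral>\<alpha>. sym_arc a b (real d * \<alpha>) * sym_arc a b (real e * \<alpha>) \<partial>circle)
    \<le> 4 * (b - a)\<^sup>2 + 4 * (b - a) * (real (gcd d e) / real (max d e))"
proof -
  define g where "g = gcd d e"
  define d' e' where "d' = d div g" and "e' = e div g"
  have eqs: "d = d' * g" "e = e' * g" by (simp_all add: d'_def e'_def g_def)
  have cop: "coprime d' e'" using pos by (simp add: d'_def e'_def g_def div_gcd_coprime)
  have pos': "g > 0" "d' > 0" "e' > 0" using pos eqs by (auto intro: Nat.gr0I)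
  define h where "h = (\<lambda>\<alpha>. sym_arc a b (real d' * \<alpha>) * sym_arc a b (real e' * \<alpha>))"
  have per: "h (x + 1) = h x" for x
    using sym_arc_add_int[of a b "real d' * x" "int d'"] sym_arc_add_int[of a b "real e' * x" "int e'"]
    by (simp add: h_def algebra_simps)
  have "(\<integral>\<alpha>. sym_arc a b (real d * \<alpha>) * sym_arc a b (real e * \<alpha>) \<partial>circle) = (\<integral>\<alpha>. h (real g * \<alpha>) \<partial>circle)"
    by (simp add: h_def eqs mult.assoc)
  also have "\<dots> = (\<integral>\<alpha>. h \<alpha> \<partial>circle)"
    using per pos' by (intro integral_circle_mult) (auto simp: h_def sym_arc_nonneg)
  also have "\<dots> \<le> 4 * (b - a)\<^sup>2 + 4 * (b - a) / real (max d' e')"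
  proof (cases "d' \<le> e'")
    case True
    then show ?thesis
      using integral_sym_arc_mult_coprime_le[OF ab pos'(3) cop] by (simp add: h_def max_def)
  next
    case False
    then show ?thesis
      using integral_sym_arc_mult_coprime_le[OF ab pos'(2), of e'] cop
      by (simp add: h_def max_def mult.commute coprime_commute)
  qed
  also have "4 * (b - a) / real (max d' e') = 4 * (b - a) * (real g / real (max d e))"
  proof -
    have "max d e = max d' e' * g" using pos' by (simp add: eqs nat_mult_max_left)
    then show ?thesis using pos' by simp
  qed
  finally show ?thesis by (simp add: g_def)
qed

text \<open>Each arc function has mean exactly \<open>2 * (b - a)\<close>, so centring cancels the
  quadratic term of the correlation bound and only a term linear in \<open>b - a\<close> remains.
  Upper bounds on the covariances suffice because all coefficients are 1.\<close>

lemma sym_arc_sum_second_moment_le: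
  fixes \<delta> :: "'a \<Rightarrow> nat"
  assumes ab: "0 \<le> a" "a \<le> b" "b \<le> 1" and P: "finite P" "\<And>p. p \<in> P \<Longrightarrow> \<delta> p > 0"
  shows "(\<integral>\<alpha>. (\<Sum>p\<in>P. sym_arc a b (real (\<delta> p) * \<alpha>) - 2 * (b - a))\<^sup>2 \<partial>circle)
    \<le> 4 * (b - a) * (\<Sum>p\<in>P. \<Sum>q\<in>P. real (gcd (\<delta> p) (\<delta> q)) / real (max (\<delta> p) (\<delta> q)))"
proof -
  define f where "f = (\<lambda>p \<alpha>. sym_arc a b (real (\<delta> p) * \<alpha>))"
  define l where "l = 2 * (b - a)"
  have f: "0 \<le> f p x" "f p x \<le> 2" for p x by (simp_all add: f_def sym_arc_nonneg sym_arc_le_2)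
  have [measurable]: "f p \<in> borel_measurable borel" for p unfolding f_def by measurable
  have int1: "integrable circle (f p)" for p
    using f by (intro integrable_circle_bounded[where B = 2]) auto
  have int2: "integrable circle (\<lambda>\<alpha>. f p \<alpha> * f q \<alpha>)" for p q
    using f mult_mono[of "f p _" 2 "f q _" 2] by (intro integrable_circle_bounded[where B = 4]) auto
  have cov: "(\<integral>\<alpha>. (f p \<alpha> - l) * (f q \<alpha> - l) \<partial>circle)
      \<le> 4 * (b - a) * (real (gcd (\<delta> p) (\<delta> q)) / real (max (\<delta> p) (\<delta> q)))" if "p \<in> P" "q \<in> P" for p q
  proof -
    have "(\<integral>\<alpha>. (f p \<alpha> - l) * (f q \<alpha> - l) \<partial>circle)
        = (\<integral>\<alpha>. f p \<alpha> * f q \<alpha> - l * f p \<alpha> - l * f q \<alpha> + l\<^sup>2 \<partial>circle)"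
      by (intro Bochner_Integration.integral_cong) (auto simp: algebra_simps power2_eq_square)
    also have "\<dots> = (\<integral>\<alpha>. f p \<alpha> * f q \<alpha> \<partial>circle) - l * (\<integral>\<alpha>. f p \<alpha> \<partial>circle) - l * (\<integral>\<alpha>. f q \<alpha> \<partial>circle) + l\<^sup>2"
      using int1 int2 by simp
    also have "\<dots> = (\<integral>\<alpha>. f p \<alpha> * f q \<alpha> \<partial>circle) - l\<^sup>2"
      using ab P that by (simp add: f_def integral_sym_arc l_def power2_eq_square)
    also have "\<dots> \<le> 4 * (b - a) * (real (gcd (\<delta> p) (\<delta> q)) / real (max (\<delta> p) (\<delta> q)))"
      using integral_sym_arc_mult_le[OF ab P(2)[OF that(1)] P(2)[OF that(2)]]
      unfolding f_def l_def power_mult_distrib by simp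
    finally show ?thesis .
  qed
  have int3: "integrable circle (\<lambda>\<alpha>. (f p \<alpha> - l) * (f q \<alpha> - l))" for p q
  proof (rule integrable_circle_bounded[where B = 4])
    fix x
    have "\<bar>f p x - l\<bar> \<le> 2" "\<bar>f q x - l\<bar> \<le> 2" using f[of p x] f[of q x] ab by (auto simp: l_def)
    then show "\<bar>(f p x - l) * (f q x - l)\<bar> \<le> 4"
      using mult_mono[of "\<bar>f p x - l\<bar>" 2 "\<bar>f q x - l\<bar>" 2] by (simp add: abs_mult)
  qed measurable
  have "(\<integral>\<alpha>. (\<Sum>p\<in>P. f p \<alpha> - l)\<^sup>2 \<partial>circle) = (\<integral>\<alpha>. (\<Sum>p\<in>P. \<Sum>q\<in>P. (f p \<alpha> - l) * (f q \<alpha> - l)) \<partial>circle)"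
    by (simp add: power2_eq_square sum_product)
  also have "\<dots> = (\<Sum>p\<in>P. \<Sum>q\<in>P. \<integral>\<alpha>. (f p \<alpha> - l) * (f q \<alpha> - l) \<partial>circle)"
    using int3 by (simp add: Bochner_Integration.integral_sum)
  also have "\<dots> \<le> (\<Sum>p\<in>P. \<Sum>q\<in>P. 4 * (b - a) * (real (gcd (\<delta> p) (\<delta> q)) / real (max (\<delta> p) (\<delta> q))))"
    by (intro sum_mono cov)
  finally show ?thesis by (simp add: f_def l_def sum_distrib_left)
qed

section \<open>Dyadic chaining\<close>

text \<open>The binary expansion of n leads from 0 to n using at most one increment per level.
  Enlarging that increment to the l2 norm of its whole level removes the dependence on n. In the
  induction \<open>g (2 * j)\<close> carries the higher bits and level 0 the last bit.\<close>

lemma dyadic_chaining_abs: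
  fixes g :: "nat \<Rightarrow> real"
  assumes "g 0 = 0" "n \<le> 2 ^ k"
  shows "\<bar>g n\<bar> \<le> (\<Sum>i\<le>k. sqrt (\<Sum>b<2 ^ (k - i). (g ((b + 1) * 2 ^ i) - g (b * 2 ^ i))\<^sup>2))"
  using assms
proof (induction k arbitrary: g n)
  case 0
  then have "n = 0 \<or> n = 1" by auto
  then show ?case using 0 by auto
next
  case (Suc k)
  define m where "m = n div 2"
  define s where "s = (\<lambda>g k i. sqrt (\<Sum>b<2 ^ (k - i). (g ((b + 1) * 2 ^ i) - g (b * 2 ^ i :: nat) :: real)\<^sup>2))"
  have m: "m \<le> 2 ^ k" using Suc.prems by (simp add: m_def)
  have shift: "s (\<lambda>j. g (2 * j)) k i = s g (Suc k) (Suc i)" for i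
    by (simp add: s_def mult_ac)
  have "\<bar>g (2 * m)\<bar> \<le> (\<Sum>i\<le>k. s (\<lambda>j. g (2 * j)) k i)"
    using Suc.IH[of "\<lambda>j. g (2 * j)" m] Suc.prems m by (simp add: s_def)
  then have even: "\<bar>g (2 * m)\<bar> \<le> (\<Sum>i\<le>k. s g (Suc k) (Suc i))" by (simp add: shift)
  have odd: "\<bar>g n - g (2 * m)\<bar> \<le> s g (Suc k) 0"
  proof (cases "even n")
    case True
    then show ?thesis by (simp add: m_def s_def sum_nonneg)
  next
    case False
    then have n: "n = 2 * m + 1" by (simp add: m_def)
    then have "2 * m < 2 ^ Suc k" using Suc.prems by simp
    then have "(g (2 * m + 1) - g (2 * m))\<^sup>2 \<le> (\<Sum>b<2 ^ Suc k. (g (b + 1) - g b)\<^sup>2)"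
      by (intro member_le_sum[of "2 * m" _ "\<lambda>b. (g (b + 1) - g b)\<^sup>2"]) auto
    then have "sqrt ((g n - g (2 * m))\<^sup>2) \<le> s g (Suc k) 0"
      unfolding s_def n by (intro real_sqrt_le_mono) simp
    then show ?thesis by simp
  qed
  have "\<bar>g n\<bar> \<le> s g (Suc k) 0 + (\<Sum>i\<le>k. s g (Suc k) (Suc i))" using even odd by linarith
  also have "\<dots> = (\<Sum>i\<le>Suc k. s g (Suc k) i)" by (rule sum.atMost_Suc_shift[symmetric])
  finally show ?case by (simp only: s_def)
qed

text \<open>A deterministic form of the Rademacher-Menshov inequality. The right side does not
  involve n, so integrating it controls the maximum over all \<open>n \<le> 2 ^ k\<close>;
  Cauchy-Schwarz over the levels costs the factor \<open>k + 1\<close>.\<close>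

lemma dyadic_chaining:
  fixes g :: "nat \<Rightarrow> real"
  assumes "g 0 = 0" "n \<le> 2 ^ k"
  shows "(g n)\<^sup>2 \<le> (real k + 1) * (\<Sum>i\<le>k. \<Sum>b<2 ^ (k - i). (g ((b + 1) * 2 ^ i) - g (b * 2 ^ i))\<^sup>2)"
proof -
  define s where "s = (\<lambda>i. \<Sum>b<2 ^ (k - i). (g ((b + 1) * 2 ^ i) - g (b * 2 ^ i))\<^sup>2)"
  have s0: "s i \<ge> 0" for i by (simp add: s_def sum_nonneg)
  have "(g n)\<^sup>2 \<le> (\<Sum>i\<le>k. sqrt (s i))\<^sup>2"
    using power_mono[OF dyadic_chaining_abs[of g n k, OF assms] abs_ge_zero, of 2] by (simp only: s_def power2_abs)
  also have "\<dots> \<le> (\<Sum>i\<le>k. 1\<^sup>2) * (\<Sum>i\<le>k. (sqrt (s i))\<^sup>2)"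
    using Cauchy_Schwarz_ineq_sum[of "\<lambda>_. 1" "\<lambda>i. sqrt (s i)" "{..k}"] by simp
  also have "\<dots> = (real k + 1) * (\<Sum>i\<le>k. s i)" using s0 by simp
  finally show ?thesis by (simp only: s_def)
qed

text \<open>The one-dimensional inequality is used in n, then in j on each increment in n. Vanishing
  on both axes provides the starting value 0 for both uses.\<close>

lemma dyadic_chaining_2d:
  fixes g :: "nat \<Rightarrow> nat \<Rightarrow> real"
  assumes "\<And>j. g 0 j = 0" "\<And>n. g n 0 = 0" "n \<le> 2 ^ k" "j \<le> 2 ^ l"
  shows "(g n j)\<^sup>2 \<le> (real k + 1) * (real l + 1) *
    (\<Sum>i\<le>k. \<Sum>b<2 ^ (k - i). \<Sum>i'\<le>l. \<Sum>c<2 ^ (l - i').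
      (g ((b + 1) * 2 ^ i) ((c + 1) * 2 ^ i') - g (b * 2 ^ i) ((c + 1) * 2 ^ i')
       - (g ((b + 1) * 2 ^ i) (c * 2 ^ i') - g (b * 2 ^ i) (c * 2 ^ i')))\<^sup>2)"
proof -
  have "(g n j)\<^sup>2 \<le> (real k + 1) * (\<Sum>i\<le>k. \<Sum>b<2 ^ (k - i). (g ((b + 1) * 2 ^ i) j - g (b * 2 ^ i) j)\<^sup>2)"
    using dyadic_chaining[of "\<lambda>n. g n j"] assms by blast
  also have "\<dots> \<le> (real k + 1) * (\<Sum>i\<le>k. \<Sum>b<2 ^ (k - i). (real l + 1) * (\<Sum>i'\<le>l. \<Sum>c<2 ^ (l - i').
      (g ((b + 1) * 2 ^ i) ((c + 1) * 2 ^ i') - g (b * 2 ^ i) ((c + 1) * 2 ^ i')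
       - (g ((b + 1) * 2 ^ i) (c * 2 ^ i') - g (b * 2 ^ i) (c * 2 ^ i')))\<^sup>2))"
    using assms
    by (intro mult_left_mono sum_mono dyadic_chaining[of "\<lambda>j. g (_ * 2 ^ _) j - g (_ * 2 ^ _) j"]) auto
  finally show ?thesis by (simp add: sum_distrib_left mult_ac)
qed

section \<open>Pairs of indices and additive energy\<close>

text \<open>Only the larger index is confined to the block (u, v]; the smaller one may lie at or
  below u. Consecutive blocks thus partition all pairs, and the increment of a pair count from u to
  v is a sum over one block.\<close>

definition pairs_in :: "nat \<Rightarrow> nat \<Rightarrow> (nat \<times> nat) set" where
  "pairs_in u v = {(m, n). 1 \<le> m \<and> m < n \<and> u < n \<and> n \<le> v}"

definition gap :: "(nat \<Rightarrow> int) \<Rightarrow> nat \<times> nat \<Rightarrow> nat" where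
  "gap x = (\<lambda>(m, n). nat \<bar>x m - x n\<bar>)"

lemma pairs_in_subset: "pairs_in u v \<subseteq> {1..v} \<times> {1..v}"
  by (auto simp: pairs_in_def)

lemma finite_pairs_in [simp]: "finite (pairs_in u v)"
  by (rule finite_subset[OF pairs_in_subset]) simp

lemma card_pairs_in_le: "card (pairs_in u v) \<le> v * v"
  using card_mono[OF _ pairs_in_subset[of u v]] by simp

lemma card_pairs_in_0: "real (card (pairs_in 0 v)) = real v * (real v - 1) / 2"
proof (induction v)
  case 0
  have "pairs_in 0 0 = {}" by (auto simp: pairs_in_def)
  then show ?case by simp
next
  case (Suc v)
  have "pairs_in 0 (Suc v) = pairs_in 0 v \<union> (\<lambda>m. (m, Suc v)) ` {1..v}"
    by (auto simp: pairs_in_def)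
  moreover have "pairs_in 0 v \<inter> (\<lambda>m. (m, Suc v)) ` {1..v} = {}" by (auto simp: pairs_in_def)
  moreover have "card ((\<lambda>m. (m, Suc v)) ` {1..v}) = v" by (subst card_image) (auto simp: inj_on_def)
  ultimately have "card (pairs_in 0 (Suc v)) = card (pairs_in 0 v) + v"
    by (simp add: card_Un_disjoint)
  then show ?case using Suc by (simp add: field_simps)
qed

lemma pairs_in_Un: "u \<le> v \<Longrightarrow> pairs_in 0 v = pairs_in 0 u \<union> pairs_in u v"
  and pairs_in_disjoint: "v \<le> u \<Longrightarrow> pairs_in w v \<inter> pairs_in u t = {}"
  by (auto simp: pairs_in_def)

lemma gap_pos:
  assumes "inj_on x {1..}" "p \<in> pairs_in u v"
  shows "gap x p > 0"
proof -
  obtain m n where p: "p = (m, n)" "1 \<le> m" "m < n" using assms by (auto simp: pairs_in_def)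
  then have "x m \<noteq> x n" using inj_onD[OF assms(1), of m n] by auto
  then show ?thesis using p by (simp add: gap_def)
qed

text \<open>\<open>\<sigma>\<close> orders each pair with the larger term of the sequence first,
  which turns equal absolute differences into equal signed ones. It is injective because the
  unordered pair determines the pair with \<open>m < n\<close>.\<close>

lemma card_equal_gaps_le_energy:
  assumes "inj_on x {1..}"
  shows "card {(p, q). p \<in> pairs_in 0 N \<and> q \<in> pairs_in 0 N \<and> gap x p = gap x q} \<le> additive_energy x N"
proof -
  define \<sigma> where "\<sigma> = (\<lambda>(m, n). if x m > x n then (m, n) else (n, m :: nat))"
  define F where "F = (\<lambda>(p, q). case (\<sigma> p, \<sigma> q) of ((n1, n2), (n3, n4)) \<Rightarrow> (n1, n2, n3, n4))"
  have \<sigma>: "\<sigma> p = \<sigma> q \<Longrightarrow> p = q" if "p \<in> pairs_in 0 N" "q \<in> pairs_in 0 N" for p q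
    using that by (auto simp: \<sigma>_def pairs_in_def split: if_splits)
  have inj: "inj_on F {(p, q). p \<in> pairs_in 0 N \<and> q \<in> pairs_in 0 N \<and> gap x p = gap x q}"
  proof (rule inj_onI, clarify)
    fix m n m' n' k l k' l'
    assume "(m, n) \<in> pairs_in 0 N" "(m', n') \<in> pairs_in 0 N" "(k, l) \<in> pairs_in 0 N" "(k', l') \<in> pairs_in 0 N"
      and "F ((m, n), (m', n')) = F ((k, l), (k', l'))"
    then have "\<sigma> (m, n) = \<sigma> (k, l)" "\<sigma> (m', n') = \<sigma> (k', l')"
      by (auto simp: F_def split: prod.splits)
    then show "((m, n) = (k, l)) \<and> (m', n') = (k', l')"
      using \<sigma> \<open>(m, n) \<in> pairs_in 0 N\<close> \<open>(m', n') \<in> pairs_in 0 N\<close> \<open>(k, l) \<in> pairs_in 0 N\<close> \<open>(k', l') \<in> pairs_in 0 N\<close>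
      by blast
  qed
  define Q where "Q = {(n1, n2, n3, n4). n1 \<in> {1..N} \<and> n2 \<in> {1..N} \<and> n3 \<in> {1..N} \<and> n4 \<in> {1..N} \<and>
             x n1 - x n2 = x n3 - x n4}"
  have "F ` {(p, q). p \<in> pairs_in 0 N \<and> q \<in> pairs_in 0 N \<and> gap x p = gap x q} \<subseteq> Q"
    unfolding Q_def F_def \<sigma>_def pairs_in_def gap_def by (auto split: if_splits)
  moreover have "finite Q"
    by (rule finite_subset[of _ "{1..N} \<times> {1..N} \<times> {1..N} \<times> {1..N}"]) (auto simp: Q_def)
  ultimately have "card (F ` {(p, q). p \<in> pairs_in 0 N \<and> q \<in> pairs_in 0 N \<and> gap x p = gap x q}) \<le> card Q"
    by (intro card_mono)
  then show ?thesis
    unfolding additive_energy_def Q_def[symmetric] card_image[OF inj] .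
qed

definition gap_energy :: "(nat \<Rightarrow> int) \<Rightarrow> nat \<Rightarrow> nat \<Rightarrow> nat" where
  "gap_energy x u v = card {(p, q). p \<in> pairs_in u v \<and> q \<in> pairs_in u v \<and> gap x p = gap x q}"

text \<open>Coincidences inside different blocks are disjoint sets of coincidences in the full
  range. A whole dyadic level therefore costs one additive energy, not one per block.\<close>

lemma sum_gap_energy_blocks_le:
  assumes "inj_on x {1..}"
  shows "(\<Sum>b<B. gap_energy x (b * h) ((b + 1) * h)) \<le> additive_energy x (B * h)"
proof -
  define Z where "Z = (\<lambda>u v. {(p, q). p \<in> pairs_in u v \<and> q \<in> pairs_in u v \<and> gap x p = gap x q})"
  have fin: "finite (Z u v)" for u v
    by (rule finite_subset[of _ "pairs_in u v \<times> pairs_in u v"]) (auto simp: Z_def)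
  have "(\<Sum>b<B. gap_energy x (b * h) ((b + 1) * h)) = (\<Sum>b<B. card (Z (b * h) ((b + 1) * h)))"
    by (simp add: gap_energy_def Z_def)
  also have "\<dots> = card (\<Union>b<B. Z (b * h) ((b + 1) * h))"
  proof (rule card_UN_disjoint[symmetric], simp, use fin in simp, intro ballI impI)
    fix b c assume "b \<in> {..<B}" "c \<in> {..<B}" "b \<noteq> c"
    then consider "(b + 1) * h \<le> c * h" | "(c + 1) * h \<le> b * h"
      by (metis Suc_eq_plus1 Suc_leI linorder_neqE_nat mult_le_mono1)
    then have "pairs_in (b * h) ((b + 1) * h) \<inter> pairs_in (c * h) ((c + 1) * h) = {}"
      by cases (use pairs_in_disjoint in blast)+
    then show "Z (b * h) ((b + 1) * h) \<inter> Z (c * h) ((c + 1) * h) = {}" by (auto simp: Z_def)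
  qed
  also have "\<dots> \<le> card (Z 0 (B * h))"
  proof (rule card_mono[OF fin], rule UN_least)
    fix b assume "b \<in> {..<B}"
    then have "(b + 1) * h \<le> B * h" by (intro mult_le_mono1) simp
    then have "pairs_in (b * h) ((b + 1) * h) \<subseteq> pairs_in 0 (B * h)" by (auto simp: pairs_in_def)
    then show "Z (b * h) ((b + 1) * h) \<subseteq> Z 0 (B * h)" by (auto simp: Z_def)
  qed
  also have "\<dots> \<le> additive_energy x (B * h)"
    using card_equal_gaps_le_energy[OF assms] by (simp add: Z_def)
  finally show ?thesis .
qed

lemma sum_over_fibres:
  fixes f :: "'a \<Rightarrow> 'b" and K :: "'b \<Rightarrow> 'b \<Rightarrow> real"
  assumes "finite P"
  defines "r \<equiv> (\<lambda>d. real (card {p\<in>P. f p = d}))"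
  shows "(\<Sum>p\<in>P. \<Sum>q\<in>P. K (f p) (f q)) = (\<Sum>d\<in>f ` P. \<Sum>e\<in>f ` P. K d e * r d * r e)"
    and "(\<Sum>d\<in>f ` P. (r d)\<^sup>2) = real (card {(p, q). p \<in> P \<and> q \<in> P \<and> f p = f q})"
proof -
  have one: "(\<Sum>p\<in>P. h (f p)) = (\<Sum>d\<in>f ` P. r d * h d)" for h :: "'b \<Rightarrow> real"
    using assms(1) by (subst sum.image_gen[of P _ f]) (auto simp: r_def intro!: sum.cong)
  show "(\<Sum>p\<in>P. \<Sum>q\<in>P. K (f p) (f q)) = (\<Sum>d\<in>f ` P. \<Sum>e\<in>f ` P. K d e * r d * r e)"
    by (simp add: one one[of "\<lambda>d. \<Sum>e\<in>f ` P. r e * K d e"] sum_distrib_left mult_ac)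
  have "{(p, q). p \<in> P \<and> q \<in> P \<and> f p = f q} = Sigma P (\<lambda>p. {q\<in>P. f q = f p})" by auto
  then have "real (card {(p, q). p \<in> P \<and> q \<in> P \<and> f p = f q}) = (\<Sum>p\<in>P. r (f p))"
    using assms(1) by (simp add: card_SigmaI r_def)
  then show "(\<Sum>d\<in>f ` P. (r d)\<^sup>2) = real (card {(p, q). p \<in> P \<and> q \<in> P \<and> f p = f q})"
    by (simp add: one power2_eq_square)
qed

section \<open>The number variance as an integral of pair counts\<close>

text \<open>A window of length at most 1 meets at most one integer translate of t, namely the one
  that brings \<open>t + S / 2\<close> into \<open>{0..<1}\<close>.\<close>

lemma infsum_window_term:
  fixes S t :: real
  assumes "0 \<le> S" "S \<le> 1"
  shows "(\<Sum>\<^sub>\<infinity>j\<in>(UNIV :: int set). indicat_real {- S / 2..<S / 2} (t + of_int j))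
    = indicat_real {0..<S} (frac (t + S / 2))"
proof -
  define j0 where "j0 = - \<lfloor>t + S / 2\<rfloor>"
  have fr: "t + S / 2 + of_int j0 = frac (t + S / 2)" by (simp add: j0_def frac_def)
  have "indicat_real {- S / 2..<S / 2} (t + of_int j) = 0" if "j \<noteq> j0" for j
  proof (rule ccontr)
    assume "\<not> ?thesis"
    then have "- S / 2 \<le> t + of_int j" "t + of_int j < S / 2" by (auto simp: indicator_def split: if_splits)
    then have "0 \<le> (t + S / 2) - of_int (- j)" "(t + S / 2) - of_int (- j) < 1" using assms by auto
    then have "\<lfloor>t + S / 2\<rfloor> = - j" by (intro floor_unique) auto
    then show False using that by (simp add: j0_def)
  qed
  then have "(\<Sum>\<^sub>\<infinity>j\<in>(UNIV :: int set). indicat_real {- S / 2..<S / 2} (t + of_int j))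
    = (\<Sum>\<^sub>\<infinity>j\<in>{j0}. indicat_real {- S / 2..<S / 2} (t + of_int j))"
    by (intro infsum_cong_neutral) auto
  also have "\<dots> = indicat_real {- S / 2..<S / 2} (t + of_int j0)" by simp
  also have "\<dots> = indicat_real {0..<S} (frac (t + S / 2))"
    unfolding fr[symmetric] by (auto simp: indicator_def)
  finally show ?thesis .
qed

lemma set_integral_unit_eq_circle:
  fixes f :: "real \<Rightarrow> real"
  assumes [measurable]: "f \<in> borel_measurable borel"
  shows "(LBINT y:{0..1}. f y) = (\<integral>y. f y \<partial>circle)"
proof -
  have "(LBINT y:{0..1}. f y) = (LBINT y:{0..<1}. f y)"
    unfolding set_lebesgue_integral_def
    by (intro integral_cong_AE) (measurable, use AE_lborel_singleton[of "1::real"] in eventually_elim, auto simp: indicator_def)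
  also have "\<dots> = (\<integral>y. f y \<partial>circle)"
    unfolding circle_def set_lebesgue_integral_def by (subst integral_restrict_space) auto
  finally show ?thesis .
qed

text \<open>The length of the intersection of an arc of length S with its translate by w. For
  \<open>0 \<le> S \<le> 1 / 2\<close> it is the tent function of the distance from w to the nearest
  integer.\<close>

definition overlap :: "real \<Rightarrow> real \<Rightarrow> real" where
  "overlap S w = (\<integral>y. indicat_real {0..<S} (frac y) * indicat_real {0..<S} (frac (y + w)) \<partial>circle)"

lemma integral_window_product:
  "(\<integral>y. indicat_real {0..<S} (frac (u - y)) * indicat_real {0..<S} (frac (v - y)) \<partial>circle) = overlap S (v - u)"
proof -
  define g where "g = (\<lambda>y. indicat_real {0..<S} (frac (u + y)) * indicat_real {0..<S} (frac (v + y)))"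
  have [measurable]: "g \<in> borel_measurable borel" unfolding g_def by measurable
  have per: "g (y + 1) = g y" for y
    using frac_1_eq[of "u + y"] frac_1_eq[of "v + y"] by (simp add: g_def add.assoc)
  have nn: "g y \<ge> 0" for y by (simp add: g_def)
  have "(\<integral>y. indicat_real {0..<S} (frac (u - y)) * indicat_real {0..<S} (frac (v - y)) \<partial>circle) = (\<integral>y. g (- y) \<partial>circle)"
    by (simp add: g_def)
  also have "\<dots> = (\<integral>y. g y \<partial>circle)" by (intro integral_circle_uminus per nn) simp
  also have "\<dots> = (\<integral>y. g (y + (- u)) \<partial>circle)" by (intro integral_circle_shift[symmetric] per nn) simp
  also have "\<dots> = overlap S (v - u)" by (simp add: g_def overlap_def algebra_simps)
  finally show ?thesis .
qed

lemma overlap_0: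
  assumes "0 \<le> S" "S \<le> 1"
  shows "overlap S 0 = S"
proof -
  have "overlap S 0 = (\<integral>y. indicat_real {0..<S} (frac y) \<partial>circle)"
    unfolding overlap_def by (intro Bochner_Integration.integral_cong) (auto simp: indicator_def)
  then show ?thesis using integral_indicator_frac[of 0 S] assms by simp
qed

text \<open>The two terms come from the points that do not wrap around 1 under translation and those
  that do. For integral w the right side would be 2 S, while the overlap is S; this case is excluded
  here.\<close>

lemma overlap_eq:
  assumes "0 \<le> S" "S \<le> 1" "w \<notin> \<int>"
  shows "overlap S w = max 0 (S - frac w) + max 0 (S - frac (- w))"
proof -
  define v where "v = frac w"
  have v: "0 < v" "v < 1" "frac (- w) = 1 - v"
    using assms frac_lt_1[of w] by (auto simp: v_def frac_neg)
  have pt: "indicat_real {0..<S} (frac y) * indicat_real {0..<S} (frac (y + w))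
      = indicat_real {0..<max 0 (S - v)} (frac y) + indicat_real {1 - v..<max (1 - v) S} (frac y)"
    if "y \<in> {0..<1}" for y
  proof -
    have y: "frac y = y" using that by simp
    have "frac (y + w) = (if y + v < 1 then y + v else y + v - 1)"
      using frac_add[of y w] y by (simp add: v_def)
    then show ?thesis using v that assms y by (auto simp: indicator_def)
  qed
  have "overlap S w = (\<integral>y. indicat_real {0..<max 0 (S - v)} (frac y) + indicat_real {1 - v..<max (1 - v) S} (frac y) \<partial>circle)"
    unfolding overlap_def using pt by (intro Bochner_Integration.integral_cong) auto
  also have "\<dots> = (\<integral>y. indicat_real {0..<max 0 (S - v)} (frac y) \<partial>circle)
      + (\<integral>y. indicat_real {1 - v..<max (1 - v) S} (frac y) \<partial>circle)"
    by (intro Bochner_Integration.integral_add integrable_circle_bounded[where B = 1]) (auto simp: indicator_def)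
  also have "\<dots> = max 0 (S - v) + (max (1 - v) S - (1 - v))"
    using v assms by (subst (1 2) integral_indicator_frac) auto
  finally show ?thesis using v by (simp add: v_def[symmetric] max_def)
qed

lemma overlap_uminus:
  assumes "0 \<le> S" "S \<le> 1" "w \<notin> \<int>"
  shows "overlap S (- w) = overlap S w"
  using assms by (simp add: overlap_eq)

text \<open>Layer-cake formula: \<open>max 0 (S - v)\<close> is the integral over s from 0 to S of
  the indicator of \<open>v < s\<close>. This replaces tent functions by arc indicators, whose
  correlations are controlled above.\<close>

lemma set_integrable_sym_arc: "set_integrable lborel {0..S} (\<lambda>s. sym_arc 0 s w)"
  and overlap_eq_integral_sym_arc:
    "0 \<le> S \<Longrightarrow> S \<le> 1 \<Longrightarrow> w \<notin> \<int> \<Longrightarrow> overlap S w = (LBINT s:{0..S}. sym_arc 0 s w)"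
proof -
  have ind: "indicat_real {0..S} s * indicat_real {0..<s} v = indicat_real ({v<..} \<inter> {0..S}) s" if "v \<ge> 0" for s v
    using that by (auto simp: indicator_def)
  have set: "{v<..} \<inter> {0..S} = {v<..S}" if "v \<ge> 0" for v using that by auto
  have int: "integrable lborel (\<lambda>s. indicat_real {0..S} s * indicat_real {0..<s} v)"
    and val: "(LBINT s. indicat_real {0..S} s * indicat_real {0..<s} v) = max 0 (S - v)" if "v \<ge> 0" for v
    unfolding ind[OF that] set[OF that]
    by (cases "v \<le> S"; auto simp: max_def intro!: integrable_real_indicator)+
  show "set_integrable lborel {0..S} (\<lambda>s. sym_arc 0 s w)"
    unfolding set_integrable_def sym_arc_def
    using int[of "frac w"] int[of "frac (- w)"] by (simp add: distrib_left)
  assume "0 \<le> S" "S \<le> 1" "w \<notin> \<int>"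
  have "(LBINT s:{0..S}. sym_arc 0 s w) = max 0 (S - frac w) + max 0 (S - frac (- w))"
    unfolding set_lebesgue_integral_def sym_arc_def
    using int[of "frac w"] int[of "frac (- w)"] val[of "frac w"] val[of "frac (- w)"]
    by (simp add: distrib_left)
  then show "overlap S w = (LBINT s:{0..S}. sym_arc 0 s w)"
    using overlap_eq[OF \<open>0 \<le> S\<close> \<open>S \<le> 1\<close> \<open>w \<notin> \<int>\<close>] by simp
qed

lemma number_variance_eq_overlaps:
  assumes S: "0 \<le> S" "S \<le> 1"
  shows "number_variance x N S \<alpha> =
    (\<Sum>m=1..N. \<Sum>n=1..N. overlap S (\<alpha> * of_int (x n - x m))) - (real N)\<^sup>2 * S\<^sup>2"
proof -
  define P where "P = (\<lambda>n y. indicat_real {0..<S} (frac (\<alpha> * of_int (x n) + S / 2 - y)))"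
  have [measurable]: "P n \<in> borel_measurable borel" for n unfolding P_def by measurable
  have w: "window_count x \<alpha> N S y = (\<Sum>n=1..N. P n y)" for y
    unfolding window_count_def P_def infsum_window_term[OF S] by (simp add: algebra_simps)
  have int: "integrable circle (\<lambda>y. P m y * P n y)" for m n
    by (intro integrable_circle_bounded[where B = 1]) (auto simp: P_def indicator_def)
  have "(LBINT y:{0..1}. (window_count x \<alpha> N S y)\<^sup>2) = (\<integral>y. (\<Sum>n=1..N. P n y)\<^sup>2 \<partial>circle)"
    unfolding w by (intro set_integral_unit_eq_circle) measurable
  also have "\<dots> = (\<integral>y. (\<Sum>m=1..N. \<Sum>n=1..N. P m y * P n y) \<partial>circle)"
    by (simp add: power2_eq_square sum_product)
  also have "\<dots> = (\<Sum>m=1..N. \<Sum>n=1..N. \<integral>y. P m y * P n y \<partial>circle)"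
    using int by simp
  also have "\<dots> = (\<Sum>m=1..N. \<Sum>n=1..N. overlap S (\<alpha> * of_int (x n - x m)))"
    unfolding P_def integral_window_product by (simp add: algebra_simps)
  finally show ?thesis unfolding number_variance_def by simp
qed

lemma sum_square_symmetric:
  fixes f :: "nat \<Rightarrow> nat \<Rightarrow> real"
  assumes "\<And>m n. 1 \<le> m \<Longrightarrow> m < n \<Longrightarrow> n \<le> N \<Longrightarrow> f n m = f m n"
  shows "(\<Sum>m=1..N. \<Sum>n=1..N. f m n) = (\<Sum>n=1..N. f n n) + 2 * (\<Sum>(m, n)\<in>pairs_in 0 N. f m n)"
proof -
  define D L where "D = (\<lambda>n. (n, n)) ` {1..N}" and "L = prod.swap ` pairs_in 0 N"
  have "{1..N} \<times> {1..N} = D \<union> (pairs_in 0 N \<union> L)"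
    by (auto simp: D_def L_def pairs_in_def image_iff)
  moreover have "D \<inter> (pairs_in 0 N \<union> L) = {}" "pairs_in 0 N \<inter> L = {}"
    by (auto simp: D_def L_def pairs_in_def)
  moreover have "finite D" "finite L" by (simp_all add: D_def L_def)
  ultimately have "(\<Sum>(m, n)\<in>{1..N} \<times> {1..N}. f m n)
      = (\<Sum>(m, n)\<in>D. f m n) + ((\<Sum>(m, n)\<in>pairs_in 0 N. f m n) + (\<Sum>(m, n)\<in>L. f m n))"
    by (simp add: sum.union_disjoint)
  moreover have "(\<Sum>(m, n)\<in>D. f m n) = (\<Sum>n=1..N. f n n)"
    unfolding D_def by (subst sum.reindex) (auto simp: inj_on_def)
  moreover have "(\<Sum>(m, n)\<in>L. f m n) = (\<Sum>(m, n)\<in>pairs_in 0 N. f m n)"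
    unfolding L_def using assms by (subst sum.reindex) (auto simp: pairs_in_def intro!: sum.cong)
  ultimately show ?thesis by (simp add: sum.cartesian_product)
qed

lemma number_variance_eq:
  assumes S: "0 \<le> S" "S \<le> 1" and x: "inj_on x {1..}" and irr: "\<alpha> \<notin> \<rat>"
  shows "number_variance x N S \<alpha> = real N * S +
    2 * (LBINT s:{0..S}. (\<Sum>p\<in>pairs_in 0 N. sym_arc 0 s (real (gap x p) * \<alpha>))) - (real N)\<^sup>2 * S\<^sup>2"
proof -
  have nint: "\<alpha> * of_int d \<notin> \<int>" if "d \<noteq> 0" for d :: int
  proof
    assume "\<alpha> * of_int d \<in> \<int>"
    then obtain m :: int where "\<alpha> * of_int d = of_int m" by (auto elim: Ints_cases)
    then have "\<alpha> = of_int m / of_int d" using that by (simp add: field_simps)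
    then show False using irr by simp
  qed
  have ne: "x n - x m \<noteq> 0" if "1 \<le> m" "m < n" for m n
    using inj_onD[OF x, of n m] that by auto
  have ov: "overlap S (\<alpha> * of_int (x n - x m)) = (LBINT s:{0..S}. sym_arc 0 s (real (gap x (m, n)) * \<alpha>))"
    if "1 \<le> m" "m < n" for m n
  proof -
    define w where "w = \<alpha> * of_int (x n - x m)"
    \<comment> \<open>\<open>gap\<close> forgets the sign of the difference, which is harmless
      because the overlap is even in w.\<close>
    have "real (gap x (m, n)) * \<alpha> = w \<or> real (gap x (m, n)) * \<alpha> = - w"
      by (auto simp: gap_def abs_if w_def algebra_simps)
    moreover have "w \<notin> \<int>" using nint ne that by (simp only: w_def) blast
    ultimately show ?thesis
      using overlap_eq_integral_sym_arc[OF S, of "real (gap x (m, n)) * \<alpha>"] overlap_uminus[OF S, of w]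
      unfolding w_def[symmetric] by (auto simp: minus_in_Ints_iff)
  qed
  have "(\<Sum>m=1..N. \<Sum>n=1..N. overlap S (\<alpha> * of_int (x n - x m)))
     = (\<Sum>n=1..N. overlap S (\<alpha> * of_int (x n - x n))) + 2 * (\<Sum>(m, n)\<in>pairs_in 0 N. overlap S (\<alpha> * of_int (x n - x m)))"
  proof (rule sum_square_symmetric)
    fix m n :: nat assume mn: "1 \<le> m" "m < n"
    have "\<alpha> * of_int (x m - x n) = - (\<alpha> * of_int (x n - x m))" by (simp add: algebra_simps)
    then show "overlap S (\<alpha> * of_int (x m - x n)) = overlap S (\<alpha> * of_int (x n - x m))"
      using overlap_uminus[OF S nint[OF ne[OF mn]]] by simp
  qed
  also have "(\<Sum>n=1..N. overlap S (\<alpha> * of_int (x n - x n))) = real N * S"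
    using S by (simp add: overlap_0)
  also have "(\<Sum>(m, n)\<in>pairs_in 0 N. overlap S (\<alpha> * of_int (x n - x m)))
      = (\<Sum>p\<in>pairs_in 0 N. LBINT s:{0..S}. sym_arc 0 s (real (gap x p) * \<alpha>))"
    by (intro sum.cong) (auto simp: pairs_in_def ov simp del: of_int_diff)
  also have "\<dots> = (LBINT s:{0..S}. (\<Sum>p\<in>pairs_in 0 N. sym_arc 0 s (real (gap x p) * \<alpha>)))"
    using set_integrable_sym_arc
    unfolding set_lebesgue_integral_def set_integrable_def scaleR_sum_right
    by (intro Bochner_Integration.integral_sum[symmetric])
  finally show ?thesis unfolding number_variance_eq_overlaps[OF S] by simp
qed

text \<open>\<open>N\<^sup>2 * S\<^sup>2\<close> is twice the integral of
  \<open>N\<^sup>2 * s\<close> over [0, S], so both parts merge into one integrand. Integrating a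
  uniform bound supplies the factor S, hence no relative precision is needed for short
  windows.\<close>

lemma number_variance_deviation_le:
  assumes S: "0 \<le> S" "S \<le> 1" and x: "inj_on x {1..}" and irr: "\<alpha> \<notin> \<rat>"
    and \<kappa>: "\<And>s. 0 \<le> s \<Longrightarrow> s \<le> S \<Longrightarrow>
      \<bar>(\<Sum>p\<in>pairs_in 0 N. sym_arc 0 s (real (gap x p) * \<alpha>)) - (real N)\<^sup>2 * s\<bar> \<le> \<kappa>"
  shows "\<bar>number_variance x N S \<alpha> - real N * S\<bar> \<le> 2 * \<kappa> * S"
proof -
  define A where "A = (\<lambda>s. \<Sum>p\<in>pairs_in 0 N. sym_arc 0 s (real (gap x p) * \<alpha>))"
  have A: "set_integrable lborel {0..S} A"
    using set_integrable_sym_arc unfolding A_def set_integrable_def scaleR_sum_right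
    by (intro Bochner_Integration.integrable_sum)
  have lin: "set_integrable lborel {0..S} (\<lambda>s. (real N)\<^sup>2 * s)"
    by (rule borel_integrable_atLeastAtMost') (auto intro!: continuous_intros)
  have "(LBINT s:{0..S}. (real N)\<^sup>2 * s) = (real N)\<^sup>2 * S\<^sup>2 / 2 - (real N)\<^sup>2 * 0\<^sup>2 / 2"
    unfolding set_lebesgue_integral_def
    using S by (intro integral_FTC_atLeastAtMost)
      (auto intro!: derivative_eq_intros continuous_intros simp: has_real_derivative_iff_has_vector_derivative[symmetric])
  then have "number_variance x N S \<alpha> - real N * S = 2 * (LBINT s:{0..S}. A s - (real N)\<^sup>2 * s)"
    using number_variance_eq[OF S x irr, of N] A lin by (auto simp: A_def[symmetric])
  moreover have "\<bar>LBINT s:{0..S}. A s - (real N)\<^sup>2 * s\<bar> \<le> (LBINT s:{0..S}. \<kappa>)"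
  proof -
    have "\<bar>LBINT s:{0..S}. A s - (real N)\<^sup>2 * s\<bar> \<le> (LBINT s:{0..S}. \<bar>A s - (real N)\<^sup>2 * s\<bar>)"
      using set_integral_norm_bound[of lborel "{0..S}" "\<lambda>s. A s - (real N)\<^sup>2 * s"] A lin by simp
    also have "\<dots> \<le> (LBINT s:{0..S}. \<kappa>)"
    proof (intro set_integral_mono set_integrable_abs set_integral_diff A lin)
      show "set_integrable lborel {0..S} (\<lambda>s. \<kappa>)"
        by (rule borel_integrable_atLeastAtMost') (rule continuous_on_const)
    qed (use \<kappa> in \<open>auto simp: A_def\<close>)
    finally show ?thesis .
  qed
  moreover have "(LBINT s:{0..S}. \<kappa>) = S * \<kappa>" using S by (simp add: set_lebesgue_integral_def)
  ultimately show ?thesis by (simp add: abs_mult mult.commute)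
qed

section \<open>Second moment of the chaining sum\<close>

text \<open>The window is \<open>j * h\<close>, so that both \<open>n\<close> and \<open>j\<close> can be chained dyadically.\<close>

definition discrepancy :: "(nat \<Rightarrow> int) \<Rightarrow> real \<Rightarrow> nat \<Rightarrow> nat \<Rightarrow> real \<Rightarrow> real" where
  "discrepancy x h n j \<alpha> =
     (\<Sum>p\<in>pairs_in 0 n. sym_arc 0 (real j * h) (real (gap x p) * \<alpha>) - 2 * (real j * h))"

lemma discrepancy_0: "discrepancy x h 0 j \<alpha> = 0" "discrepancy x h n 0 \<alpha> = 0"
proof -
  have "pairs_in 0 0 = {}" by (auto simp: pairs_in_def)
  then show "discrepancy x h 0 j \<alpha> = 0" by (simp add: discrepancy_def)
  show "discrepancy x h n 0 \<alpha> = 0" by (simp add: discrepancy_def sym_arc_def)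
qed

lemma discrepancy_increment:
  assumes "h \<ge> 0" "u \<le> v" "i \<le> j"
  shows "discrepancy x h v j \<alpha> - discrepancy x h u j \<alpha> - (discrepancy x h v i \<alpha> - discrepancy x h u i \<alpha>)
    = (\<Sum>p\<in>pairs_in u v. sym_arc (real i * h) (real j * h) (real (gap x p) * \<alpha>) - 2 * (real j * h - real i * h))"
proof -
  define f where "f = (\<lambda>j p. sym_arc 0 (real j * h) (real (gap x p) * \<alpha>) - 2 * (real j * h))"
  have d: "discrepancy x h v k \<alpha> - discrepancy x h u k \<alpha> = (\<Sum>p\<in>pairs_in u v. f k p)" for k
  proof -
    have "(\<Sum>p\<in>pairs_in 0 v. f k p) = (\<Sum>p\<in>pairs_in 0 u. f k p) + (\<Sum>p\<in>pairs_in u v. f k p)"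
      unfolding pairs_in_Un[OF assms(2)] by (intro sum.union_disjoint pairs_in_disjoint) auto
    then show ?thesis by (simp add: discrepancy_def f_def)
  qed
  have "real i * h \<le> real j * h" using assms by (intro mult_right_mono) auto
  then have "f j p - f i p = sym_arc (real i * h) (real j * h) (real (gap x p) * \<alpha>) - 2 * (real j * h - real i * h)" for p
    using sym_arc_diff[of 0 "real i * h" "real j * h" "real (gap x p) * \<alpha>"] assms by (simp add: f_def)
  then show ?thesis unfolding d by (simp add: sum_subtractf[symmetric])
qed

text \<open>The right side of the two-dimensional chaining inequality for
  \<open>n \<le> 2 ^ k\<close> and \<open>j \<le> 4 ^ k\<close>, hence the \<open>2 * k\<close>
  levels for the window. The mixed increments are already written as centred arc sums over one block
  and one subwindow, the shape of the second moment bound.\<close>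

definition chaining_sum :: "(nat \<Rightarrow> int) \<Rightarrow> real \<Rightarrow> nat \<Rightarrow> real \<Rightarrow> real" where
  "chaining_sum x h k \<alpha> = (\<Sum>i\<le>k. \<Sum>b<2 ^ (k - i). \<Sum>i'\<le>2 * k. \<Sum>c<2 ^ (2 * k - i').
     (\<Sum>p\<in>pairs_in (b * 2 ^ i) ((b + 1) * 2 ^ i).
        sym_arc (real (c * 2 ^ i') * h) (real ((c + 1) * 2 ^ i') * h) (real (gap x p) * \<alpha>)
        - 2 * (real ((c + 1) * 2 ^ i') * h - real (c * 2 ^ i') * h))\<^sup>2)"

lemma chaining_sum_nonneg: "chaining_sum x h k \<alpha> \<ge> 0"
  by (simp add: chaining_sum_def sum_nonneg)

lemma discrepancy_square_le:
  assumes "h \<ge> 0" "n \<le> 2 ^ k" "j \<le> 4 ^ k"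
  shows "(discrepancy x h n j \<alpha>)\<^sup>2 \<le> (real k + 1) * (real (2 * k) + 1) * chaining_sum x h k \<alpha>"
proof -
  have "j \<le> 2 ^ (2 * k)" using assms by (simp add: power_mult)
  from dyadic_chaining_2d[of "\<lambda>n j. discrepancy x h n j \<alpha>", OF discrepancy_0 assms(2) this]
  have "(discrepancy x h n j \<alpha>)\<^sup>2 \<le> (real k + 1) * (real (2 * k) + 1) *
    (\<Sum>i\<le>k. \<Sum>b<2 ^ (k - i). \<Sum>i'\<le>2 * k. \<Sum>c<2 ^ (2 * k - i').
      (discrepancy x h ((b + 1) * 2 ^ i) ((c + 1) * 2 ^ i') \<alpha> - discrepancy x h (b * 2 ^ i) ((c + 1) * 2 ^ i') \<alpha>
       - (discrepancy x h ((b + 1) * 2 ^ i) (c * 2 ^ i') \<alpha> - discrepancy x h (b * 2 ^ i) (c * 2 ^ i') \<alpha>))\<^sup>2)" .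
  also have "(\<Sum>i\<le>k. \<Sum>b<2 ^ (k - i). \<Sum>i'\<le>2 * k. \<Sum>c<2 ^ (2 * k - i').
      (discrepancy x h ((b + 1) * 2 ^ i) ((c + 1) * 2 ^ i') \<alpha> - discrepancy x h (b * 2 ^ i) ((c + 1) * 2 ^ i') \<alpha>
       - (discrepancy x h ((b + 1) * 2 ^ i) (c * 2 ^ i') \<alpha> - discrepancy x h (b * 2 ^ i) (c * 2 ^ i') \<alpha>))\<^sup>2)
     = chaining_sum x h k \<alpha>"
    unfolding chaining_sum_def
    by (intro sum.cong refl arg_cong[where f = "\<lambda>z. z\<^sup>2"] discrepancy_increment assms mult_le_mono1) auto
  finally show ?thesis .
qed

text \<open>The GCD sum is applied with r the number of pairs having a given gap, so that the sum of
  its squares is the energy of the block. L may exceed \<open>v * v\<close>, so that a single L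
  serves all blocks of one scale.\<close>

lemma gap_sum_second_moment_bound:
  fixes \<tau> :: real
  assumes "\<tau> > 0"
  obtains C where "C > 0"
    "\<And>x u v L a b. inj_on x {1..} \<Longrightarrow> v * v \<le> L \<Longrightarrow> L \<ge> 1 \<Longrightarrow> 0 \<le> a \<Longrightarrow> a \<le> b \<Longrightarrow> b \<le> 1 \<Longrightarrow>
      (\<integral>\<alpha>. (\<Sum>p\<in>pairs_in u v. sym_arc a b (real (gap x p) * \<alpha>) - 2 * (b - a))\<^sup>2 \<partial>circle)
        \<le> C * (b - a) * real L powr \<tau> * real (gap_energy x u v)"
proof (rule gcd_sum_bound[OF assms])
  fix C :: real assume C: "C > 0"
    "\<And>D L r. finite D \<Longrightarrow> D \<subseteq> {0<..} \<Longrightarrow> card D \<le> L \<Longrightarrow> L \<ge> 1 \<Longrightarrow> (\<And>d. r d \<ge> 0) \<Longrightarrow>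
      (\<Sum>d\<in>D. \<Sum>e\<in>D. real (gcd d e) / real (max d e) * r d * r e)
        \<le> C * real L powr \<tau> * (\<Sum>d\<in>D. (r d)\<^sup>2)"
  show thesis
  proof (rule that[of "4 * C"])
    fix x :: "nat \<Rightarrow> int" and u v L :: nat and a b :: real
    assume x: "inj_on x {1..}" and L: "v * v \<le> L" "L \<ge> 1" and ab: "0 \<le> a" "a \<le> b" "b \<le> 1"
    define P where "P = pairs_in u v"
    define r where "r = (\<lambda>d. real (card {p\<in>P. gap x p = d}))"
    have P: "finite P" by (simp add: P_def)
    have "card (gap x ` P) \<le> L"
      using card_image_le[OF P, of "gap x"] card_pairs_in_le[of u v] L by (simp add: P_def)
    moreover have "gap x ` P \<subseteq> {0<..}" using gap_pos[OF x] by (auto simp: P_def)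
    ultimately have form: "(\<Sum>d\<in>gap x ` P. \<Sum>e\<in>gap x ` P. real (gcd d e) / real (max d e) * r d * r e)
        \<le> C * real L powr \<tau> * (\<Sum>d\<in>gap x ` P. (r d)\<^sup>2)"
      using P L by (intro C(2)) (auto simp: r_def)
    have "(\<integral>\<alpha>. (\<Sum>p\<in>P. sym_arc a b (real (gap x p) * \<alpha>) - 2 * (b - a))\<^sup>2 \<partial>circle)
        \<le> 4 * (b - a) * (\<Sum>p\<in>P. \<Sum>q\<in>P. real (gcd (gap x p) (gap x q)) / real (max (gap x p) (gap x q)))"
      using gap_pos[OF x] by (intro sym_arc_sum_second_moment_le ab P) (auto simp: P_def)
    also have "(\<Sum>p\<in>P. \<Sum>q\<in>P. real (gcd (gap x p) (gap x q)) / real (max (gap x p) (gap x q)))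
        = (\<Sum>d\<in>gap x ` P. \<Sum>e\<in>gap x ` P. real (gcd d e) / real (max d e) * r d * r e)"
      unfolding r_def by (rule sum_over_fibres(1)[OF P, of "\<lambda>d e. real (gcd d e) / real (max d e)"])
    also have "4 * (b - a) * \<dots> \<le> 4 * (b - a) * (C * real L powr \<tau> * (\<Sum>d\<in>gap x ` P. (r d)\<^sup>2))"
      using ab form by (intro mult_left_mono) auto
    also have "(\<Sum>d\<in>gap x ` P. (r d)\<^sup>2) = real (gap_energy x u v)"
      using sum_over_fibres(2)[OF P, of "gap x"] by (simp add: r_def gap_energy_def P_def)
    finally show "(\<integral>\<alpha>. (\<Sum>p\<in>pairs_in u v. sym_arc a b (real (gap x p) * \<alpha>) - 2 * (b - a))\<^sup>2 \<partial>circle)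
        \<le> 4 * C * (b - a) * real L powr \<tau> * real (gap_energy x u v)"
      by (simp add: P_def mult_ac)
  qed (use C in simp)
qed

lemma integrable_gap_sum_square:
  "integrable circle (\<lambda>\<alpha>. (\<Sum>p\<in>pairs_in u v. sym_arc a b (real (gap x p) * \<alpha>) - l)\<^sup>2)"
proof (rule integrable_circle_bounded)
  fix \<alpha>
  have "\<bar>\<Sum>p\<in>pairs_in u v. sym_arc a b (real (gap x p) * \<alpha>) - l\<bar> \<le> (\<Sum>p\<in>pairs_in u v. 2 + \<bar>l\<bar>)"
  proof (rule order.trans[OF sum_abs], rule sum_mono)
    fix p
    show "\<bar>sym_arc a b (real (gap x p) * \<alpha>) - l\<bar> \<le> 2 + \<bar>l\<bar>"
      using sym_arc_nonneg[of a b "real (gap x p) * \<alpha>"] sym_arc_le_2[of a b "real (gap x p) * \<alpha>"] by linarith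
  qed
  then have "\<bar>\<Sum>p\<in>pairs_in u v. sym_arc a b (real (gap x p) * \<alpha>) - l\<bar>\<^sup>2 \<le> (\<Sum>p\<in>pairs_in u v. 2 + \<bar>l\<bar>)\<^sup>2"
    by (intro power_mono) auto
  then show "\<bar>(\<Sum>p\<in>pairs_in u v. sym_arc a b (real (gap x p) * \<alpha>) - l)\<^sup>2\<bar> \<le> (\<Sum>p\<in>pairs_in u v. 2 + \<bar>l\<bar>)\<^sup>2"
    by simp
qed measurable

lemma integrable_chaining_sum: "integrable circle (chaining_sum x h k)"
  unfolding chaining_sum_def[abs_def]
  by (intro Bochner_Integration.integrable_sum integrable_gap_sum_square)

text \<open>At each pair of levels the subwindow lengths add up to \<sigma> and the block energies
  to at most the full additive energy. All \<open>(k + 1) * (2 * k + 1)\<close> pairs of levels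
  therefore satisfy the same bound.\<close>

lemma integral_chaining_sum_le:
  fixes \<tau> :: real
  assumes "\<tau> > 0"
  obtains C where "C > 0"
    "\<And>x \<sigma> k. inj_on x {1..} \<Longrightarrow> 0 \<le> \<sigma> \<Longrightarrow> \<sigma> \<le> 1 \<Longrightarrow>
      (\<integral>\<alpha>. chaining_sum x (\<sigma> / 4 ^ k) k \<alpha> \<partial>circle)
        \<le> C * (real k + 1) * (real (2 * k) + 1) * \<sigma> * (4 ^ k) powr \<tau> * real (additive_energy x (2 ^ k))"
proof (rule gap_sum_second_moment_bound[OF assms])
  fix C :: real assume C: "C > 0"
    "\<And>x u v L a b. inj_on x {1..} \<Longrightarrow> v * v \<le> L \<Longrightarrow> L \<ge> 1 \<Longrightarrow> 0 \<le> a \<Longrightarrow> a \<le> b \<Longrightarrow> b \<le> 1 \<Longrightarrow>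
      (\<integral>\<alpha>. (\<Sum>p\<in>pairs_in u v. sym_arc a b (real (gap x p) * \<alpha>) - 2 * (b - a))\<^sup>2 \<partial>circle)
        \<le> C * (b - a) * real L powr \<tau> * real (gap_energy x u v)"
  show thesis
  proof (rule that[OF C(1)])
    fix x :: "nat \<Rightarrow> int" and \<sigma> :: real and k :: nat
    assume x: "inj_on x {1..}" and \<sigma>: "0 \<le> \<sigma>" "\<sigma> \<le> 1"
    define h where "h = \<sigma> / 4 ^ k"
    define W where "W = (4 ^ k) powr \<tau>"
    have h: "h \<ge> 0" using \<sigma> by (simp add: h_def)
    have W: "W \<ge> 0" by (simp add: W_def)
    have four: "(4::nat) ^ k = 2 ^ k * 2 ^ k" by (simp add: power_mult_distrib[symmetric])
    have one: "(\<integral>\<alpha>. (\<Sum>p\<in>pairs_in (b * 2 ^ i) ((b + 1) * 2 ^ i).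
        sym_arc (real (c * 2 ^ i') * h) (real ((c + 1) * 2 ^ i') * h) (real (gap x p) * \<alpha>)
        - 2 * (real ((c + 1) * 2 ^ i') * h - real (c * 2 ^ i') * h))\<^sup>2 \<partial>circle)
      \<le> C * (2 ^ i' * h) * W * real (gap_energy x (b * 2 ^ i) ((b + 1) * 2 ^ i))"
      if i: "i \<le> k" "b < 2 ^ (k - i)" "i' \<le> 2 * k" "c < 2 ^ (2 * k - i')" for i b i' c
    proof -
      have "(b + 1) * 2 ^ i \<le> 2 ^ (k - i) * 2 ^ i" using i by (intro mult_le_mono1) simp
      also have "\<dots> = 2 ^ k" using i by (simp add: power_add[symmetric])
      finally have "((b + 1) * 2 ^ i) * ((b + 1) * 2 ^ i) \<le> 4 ^ k" unfolding four by (intro mult_le_mono)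
      moreover have "real ((c + 1) * 2 ^ i') * h \<le> 1"
      proof -
        have "(c + 1) * 2 ^ i' \<le> 2 ^ (2 * k - i') * 2 ^ i'" using i by (intro mult_le_mono1) simp
        also have "\<dots> = 4 ^ k" using i by (simp add: power_add[symmetric] power_mult)
        finally have "real ((c + 1) * 2 ^ i') \<le> 4 ^ k" by (metis of_nat_le_iff of_nat_numeral of_nat_power)
        then have "real ((c + 1) * 2 ^ i') * h \<le> 4 ^ k * h" using h by (intro mult_right_mono)
        also have "4 ^ k * h \<le> 1" using \<sigma> by (simp add: h_def)
        finally show ?thesis .
      qed
      moreover have "real (c * 2 ^ i') * h \<le> real ((c + 1) * 2 ^ i') * h"
        using h by (intro mult_right_mono) auto
      moreover have "real ((c + 1) * 2 ^ i') * h - real (c * 2 ^ i') * h = 2 ^ i' * h"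
        by (simp add: algebra_simps)
      ultimately show ?thesis
        using C(2)[OF x, of "(b + 1) * 2 ^ i" "4 ^ k" "real (c * 2 ^ i') * h" "real ((c + 1) * 2 ^ i') * h" "b * 2 ^ i"] h
        by (simp add: W_def)
    qed
    have "(\<integral>\<alpha>. chaining_sum x h k \<alpha> \<partial>circle) = (\<Sum>i\<le>k. \<Sum>b<2 ^ (k - i). \<Sum>i'\<le>2 * k. \<Sum>c<2 ^ (2 * k - i').
       \<integral>\<alpha>. (\<Sum>p\<in>pairs_in (b * 2 ^ i) ((b + 1) * 2 ^ i).
        sym_arc (real (c * 2 ^ i') * h) (real ((c + 1) * 2 ^ i') * h) (real (gap x p) * \<alpha>)
        - 2 * (real ((c + 1) * 2 ^ i') * h - real (c * 2 ^ i') * h))\<^sup>2 \<partial>circle)"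
      unfolding chaining_sum_def
      by (simp only: Bochner_Integration.integral_sum Bochner_Integration.integrable_sum integrable_gap_sum_square)
    also have "\<dots> \<le> (\<Sum>i\<le>k. \<Sum>b<2 ^ (k - i). \<Sum>i'\<le>2 * k. \<Sum>c<(2::nat) ^ (2 * k - i').
        C * (2 ^ i' * h) * W * real (gap_energy x (b * 2 ^ i) ((b + 1) * 2 ^ i)))"
      by (intro sum_mono one) auto
    also have "\<dots> = (\<Sum>i\<le>k. \<Sum>b<2 ^ (k - i). \<Sum>i'\<le>2 * k. C * \<sigma> * W * real (gap_energy x (b * 2 ^ i) ((b + 1) * 2 ^ i)))"
    proof (intro sum.cong refl)
      fix i b i' :: nat assume "i' \<in> {..2 * k}"
      then have "(2::real) ^ (2 * k - i') * 2 ^ i' = 4 ^ k" by (simp add: power_add[symmetric] power_mult)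
      then have "(2::real) ^ (2 * k - i') * (2 ^ i' * h) = \<sigma>" by (simp add: h_def mult.assoc[symmetric])
      then show "(\<Sum>c<(2::nat) ^ (2 * k - i'). C * (2 ^ i' * h) * W * real (gap_energy x (b * 2 ^ i) ((b + 1) * 2 ^ i)))
          = C * \<sigma> * W * real (gap_energy x (b * 2 ^ i) ((b + 1) * 2 ^ i))"
        by (simp add: algebra_simps)
    qed
    also have "\<dots> = C * \<sigma> * W * (real (2 * k) + 1) * (\<Sum>i\<le>k. real (\<Sum>b<2 ^ (k - i). gap_energy x (b * 2 ^ i) ((b + 1) * 2 ^ i)))"
      by (simp add: sum_distrib_left algebra_simps)
    also have "\<dots> \<le> C * \<sigma> * W * (real (2 * k) + 1) * (\<Sum>i\<le>k. real (additive_energy x (2 ^ k)))"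
    proof (intro mult_left_mono sum_mono)
      fix i assume "i \<in> {..k}"
      then have "2 ^ (k - i) * 2 ^ i = (2::nat) ^ k" by (simp add: power_add[symmetric])
      then show "real (\<Sum>b<2 ^ (k - i). gap_energy x (b * 2 ^ i) ((b + 1) * 2 ^ i)) \<le> real (additive_energy x (2 ^ k))"
        using sum_gap_energy_blocks_le[OF x, of "2 ^ i" "2 ^ (k - i)"] by (simp only: of_nat_le_iff)
    qed (use C \<sigma> W in simp)
    finally show "(\<integral>\<alpha>. chaining_sum x (\<sigma> / 4 ^ k) k \<alpha> \<partial>circle)
        \<le> C * (real k + 1) * (real (2 * k) + 1) * \<sigma> * (4 ^ k) powr \<tau> * real (additive_energy x (2 ^ k))"
      by (simp add: h_def W_def mult_ac add.commute)
  qed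
qed

section \<open>Uniform asymptotics\<close>

lemma AE_tendsto_0_of_summable_integrals:
  fixes f :: "nat \<Rightarrow> 'a \<Rightarrow> real"
  assumes int: "\<And>k. integrable M (f k)" and nn: "\<And>k x. f k x \<ge> 0"
    and "summable (\<lambda>k. \<integral>x. f k x \<partial>M)"
  shows "AE x in M. (\<lambda>k. f k x) \<longlonglongrightarrow> 0"
proof -
  have [measurable]: "f k \<in> borel_measurable M" for k using int by auto
  have "(\<integral>\<^sup>+x. (\<Sum>k. ennreal (f k x)) \<partial>M) = (\<Sum>k. \<integral>\<^sup>+x. ennreal (f k x) \<partial>M)"
    by (rule nn_integral_suminf) measurable
  also have "\<dots> = (\<Sum>k. ennreal (\<integral>x. f k x \<partial>M))"
    using int nn by (simp add: nn_integral_eq_integral)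
  also have "\<dots> = ennreal (\<Sum>k. \<integral>x. f k x \<partial>M)"
    using assms(3) nn by (intro suminf_ennreal2) (auto intro: integral_nonneg_AE)
  finally have "(\<integral>\<^sup>+x. (\<Sum>k. ennreal (f k x)) \<partial>M) \<noteq> \<infinity>" by simp
  then have "AE x in M. (\<Sum>k. ennreal (f k x)) \<noteq> \<infinity>" by (intro nn_integral_PInf_AE) measurable
  then show ?thesis
  proof eventually_elim
    case (elim x)
    then have "summable (\<lambda>k. f k x)" using nn by (intro summable_suminf_not_top) auto
    then show ?case by (rule summable_LIMSEQ_zero)
  qed
qed

lemma sym_arc_mono: "s \<le> s' \<Longrightarrow> sym_arc 0 s t \<le> sym_arc 0 s' t"
  by (auto simp: sym_arc_def indicator_def)

text \<open>The count is monotone in s, so s is squeezed between neighbouring multiples of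
  \<open>h = \<sigma> / 4 ^ k\<close>. The mesh is fine enough that
  \<open>N\<^sup>2 * h \<le> N * \<sigma>\<close>; replacing \<open>N * (N - 1)\<close>, the
  centring of \<open>discrepancy\<close>, by \<open>N\<^sup>2\<close> costs at most another
  \<open>N * \<sigma>\<close>.\<close>

lemma pair_count_deviation_le:
  fixes \<alpha> \<sigma> \<kappa> s :: real
  assumes N: "1 \<le> N" "N \<le> 2 ^ k" and \<sigma>: "0 < \<sigma>" and s: "0 \<le> s" "s \<le> \<sigma>"
    and disc: "\<And>j. j \<le> 4 ^ k \<Longrightarrow> \<bar>discrepancy x (\<sigma> / 4 ^ k) N j \<alpha>\<bar> \<le> \<kappa>"
  shows "\<bar>(\<Sum>p\<in>pairs_in 0 N. sym_arc 0 s (real (gap x p) * \<alpha>)) - (real N)\<^sup>2 * s\<bar> \<le> \<kappa> + 2 * (real N * \<sigma>)"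
proof -
  define A where "A = (\<lambda>s. \<Sum>p\<in>pairs_in 0 N. sym_arc 0 s (real (gap x p) * \<alpha>))"
  define h where "h = \<sigma> / 4 ^ k"
  have h: "h > 0" using \<sigma> by (simp add: h_def)
  have mono: "A s \<le> A s'" if "s \<le> s'" for s s'
    unfolding A_def by (intro sum_mono sym_arc_mono that)
  have d: "discrepancy x h N j \<alpha> = A (real j * h) - real N * (real N - 1) * (real j * h)" for j
    by (simp add: discrepancy_def A_def sum_subtractf card_pairs_in_0)
  define i where "i = nat \<lfloor>s / h\<rfloor>"
  define j where "j = nat \<lceil>s / h\<rceil>"
  have sh: "0 \<le> s / h" "s / h \<le> 4 ^ k" using s h \<sigma> by (auto simp: h_def field_simps)
  have ri: "real i = of_int \<lfloor>s / h\<rfloor>" and rj: "real j = of_int \<lceil>s / h\<rceil>"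
    using sh by (simp_all add: i_def j_def)
  have i1: "real i \<le> s / h" "s / h < real i + 1" unfolding ri by linarith+
  have j1: "s / h \<le> real j" "real j < s / h + 1" unfolding rj by linarith+
  have "\<lceil>s / h\<rceil> \<le> 4 ^ k" using sh by (simp add: ceiling_le_iff)
  then have j4: "j \<le> 4 ^ k" unfolding j_def by (metis nat_le_iff of_nat_numeral of_nat_power)
  have i4: "i \<le> 4 ^ k" using i1(1) j1(1) j4 by linarith
  have il: "real i * h \<le> s" "s \<le> real i * h + h" using i1 h by (simp_all add: field_simps)
  have jl: "s \<le> real j * h" "real j * h \<le> s + h" using j1 h by (simp_all add: field_simps)
  have N2h: "(real N)\<^sup>2 * h \<le> real N * \<sigma>"
  proof -
    have "real N \<le> 2 ^ k" using N by (metis of_nat_le_iff of_nat_numeral of_nat_power)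
    then have "(real N)\<^sup>2 \<le> (2 ^ k)\<^sup>2" by (intro power_mono) auto
    also have "\<dots> = (4::real) ^ k" by (simp add: power2_eq_square power_mult_distrib[symmetric])
    finally have "(real N)\<^sup>2 * h \<le> 4 ^ k * h" using h by (intro mult_right_mono) auto
    also have "\<dots> = 1 * \<sigma>" by (simp add: h_def)
    also have "\<dots> \<le> real N * \<sigma>" using N \<sigma> by (intro mult_right_mono) auto
    finally show ?thesis .
  qed
  have Ns: "real N * s \<le> real N * \<sigma>" using s by (intro mult_left_mono) auto
  have "A s \<ge> real N * (real N - 1) * (real i * h) - \<kappa>"
    using mono[OF il(1)] disc[OF i4] unfolding h_def[symmetric] d by linarith
  moreover have "real N * (real N - 1) * (real i * h) \<ge> (real N)\<^sup>2 * s - (real N)\<^sup>2 * h - real N * s"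
  proof -
    have "(real N)\<^sup>2 * s \<le> (real N)\<^sup>2 * (real i * h + h)" using il by (intro mult_left_mono) auto
    moreover have "real N * (real i * h) \<le> real N * s" using il by (intro mult_left_mono) auto
    ultimately show ?thesis by (simp add: algebra_simps power2_eq_square)
  qed
  moreover have "A s \<le> real N * (real N - 1) * (real j * h) + \<kappa>"
    using mono[OF jl(1)] disc[OF j4] unfolding h_def[symmetric] d by linarith
  moreover have "real N * (real N - 1) * (real j * h) \<le> (real N)\<^sup>2 * s + (real N)\<^sup>2 * h"
  proof -
    have "real N * (real N - 1) * (real j * h) \<le> (real N)\<^sup>2 * (real j * h)"
      using h by (intro mult_right_mono) (auto simp: power2_eq_square algebra_simps)
    also have "\<dots> \<le> (real N)\<^sup>2 * (s + h)" using jl by (intro mult_left_mono) auto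
    finally show ?thesis by (simp add: algebra_simps)
  qed
  ultimately have "\<bar>A s - (real N)\<^sup>2 * s\<bar> \<le> \<kappa> + 2 * (real N * \<sigma>)"
    using N2h Ns mult_pos_pos[of "real N" \<sigma>] N \<sigma> unfolding abs_le_iff by linarith
  then show ?thesis by (simp add: A_def)
qed

text \<open>The largest window \<open>N powr - \<beta>\<close> that occurs for \<open>2 ^ (k - 1) \<le> N \<le> 2 ^ k\<close>.\<close>

definition width :: "real \<Rightarrow> nat \<Rightarrow> real" where
  "width \<beta> k = 2 powr (- \<beta> * (real k - 1))"

text \<open>The bound for the squared discrepancy, relative to the square of the scale
  \<open>2 ^ k\<close>: its convergence to 0 makes the discrepancy o(N), uniformly in N of that
  scale and in the windows.\<close>

definition chaining_bound :: "(nat \<Rightarrow> int) \<Rightarrow> real \<Rightarrow> nat \<Rightarrow> real \<Rightarrow> real" where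
  "chaining_bound x \<beta> k \<alpha> =
     (real k + 1) * (real (2 * k) + 1) * chaining_sum x (width \<beta> k / 4 ^ k) k \<alpha> / 4 ^ k"

lemma number_variance_uniform:
  assumes x: "inj_on x {1..}" and irr: "\<alpha> \<notin> \<rat>" and \<beta>: "\<beta> > 0"
    and lim: "(\<lambda>k. chaining_bound x \<beta> k \<alpha>) \<longlonglongrightarrow> 0" and \<delta>: "\<delta> > 0"
  shows "\<forall>\<^sub>F N in sequentially. \<forall>S. 0 \<le> S \<and> S \<le> real N powr (- \<beta>) \<longrightarrow>
        \<bar>number_variance x N S \<alpha> - real N * S\<bar> \<le> \<delta> * (real N * S)"
proof -
  have w0: "width \<beta> \<longlonglongrightarrow> 0" unfolding width_def[abs_def] using \<beta> by real_asymp
  \<comment> \<open>Since \<open>2 ^ k \<le> 2 * N\<close>, the discrepancy is at most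
    \<open>\<delta> / 8 * N\<close>, and the final bound is
    \<open>2 * (\<delta> / 8 + 2 * \<delta> / 16) = \<delta> / 2\<close> times \<open>N * S\<close>.
    The bound 1 on the width keeps all arcs within one period.\<close>
  have "\<forall>\<^sub>F k in sequentially. chaining_bound x \<beta> k \<alpha> < (\<delta> / 16)\<^sup>2 \<and> width \<beta> k < min 1 (\<delta> / 16)"
    using \<delta> by (intro eventually_conj order_tendstoD(2)[OF lim] order_tendstoD(2)[OF w0]) auto
  then obtain k0 where k0: "\<And>k. k \<ge> k0 \<Longrightarrow> chaining_bound x \<beta> k \<alpha> < (\<delta> / 16)\<^sup>2"
      "\<And>k. k \<ge> k0 \<Longrightarrow> width \<beta> k < 1" "\<And>k. k \<ge> k0 \<Longrightarrow> width \<beta> k < \<delta> / 16"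
    unfolding eventually_sequentially by auto
  show ?thesis
  proof (rule eventually_sequentiallyI[of "2 ^ k0"], intro allI impI)
    fix N S assume N0: "2 ^ k0 \<le> N" and S: "0 \<le> S \<and> S \<le> real N powr (- \<beta>)"
    have N1: "1 \<le> N" using N0 one_le_power[of "2::nat" k0] by linarith
    obtain n where n: "2 ^ n \<le> N" "N < 2 ^ (n + 1)" using ex_power_ivl1[of 2 N] N1 by auto
    \<comment> \<open>Rounding up keeps \<open>N \<le> 2 ^ k\<close>; the \<open>k - 1\<close> in
      \<open>width\<close> then gives \<open>\<sigma> = (2 ^ n) powr (- \<beta>)\<close>, which is
      at least \<open>N powr (- \<beta>)\<close>.\<close>
    define k where "k = n + 1"
    have Nk: "N \<le> 2 ^ k" using n by (simp add: k_def)
    have kN: "2 ^ k \<le> 2 * real N"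
    proof -
      have "2 ^ k \<le> 2 * N" using n by (simp add: k_def)
      then show ?thesis by (metis of_nat_le_iff of_nat_mult of_nat_numeral of_nat_power)
    qed
    have "(2::nat) ^ k0 \<le> 2 ^ k" using N0 Nk by linarith
    then have kk: "k0 \<le> k" by simp
    define \<sigma> where "\<sigma> = width \<beta> k"
    have \<sigma>: "0 < \<sigma>" "\<sigma> \<le> 1" "\<sigma> < \<delta> / 16" using k0[OF kk] by (auto simp: \<sigma>_def width_def)
    have "2 ^ n \<le> real N" using n(1) by (metis of_nat_le_iff of_nat_numeral of_nat_power)
    then have "real N powr (- \<beta>) \<le> (2 ^ n) powr (- \<beta>)"
      using \<beta> by (intro powr_mono2') auto
    also have "\<dots> = \<sigma>" by (simp add: \<sigma>_def width_def k_def powr_realpow[symmetric] powr_powr mult.commute)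
    finally have S\<sigma>: "S \<le> \<sigma>" using S by linarith
    have disc: "\<bar>discrepancy x (\<sigma> / 4 ^ k) N j \<alpha>\<bar> \<le> \<delta> / 8 * real N" if "j \<le> 4 ^ k" for j
    proof -
      have "(discrepancy x (\<sigma> / 4 ^ k) N j \<alpha>)\<^sup>2 \<le> (real k + 1) * (real (2 * k) + 1) * chaining_sum x (\<sigma> / 4 ^ k) k \<alpha>"
        using \<sigma> by (intro discrepancy_square_le Nk that) auto
      also have "\<dots> = chaining_bound x \<beta> k \<alpha> * 4 ^ k" by (simp add: chaining_bound_def \<sigma>_def)
      also have "\<dots> \<le> (\<delta> / 16)\<^sup>2 * 4 ^ k" using k0(1)[OF kk] by (intro mult_right_mono) auto
      also have "\<dots> = (\<delta> / 16 * 2 ^ k)\<^sup>2"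
        unfolding power_mult_distrib by (simp add: power_even_eq[symmetric] power_mult)
      finally have "\<bar>discrepancy x (\<sigma> / 4 ^ k) N j \<alpha>\<bar> \<le> \<bar>\<delta> / 16 * 2 ^ k\<bar>"
        by (simp only: abs_le_square_iff)
      also have "\<dots> = \<delta> / 16 * 2 ^ k" using \<delta> by (intro abs_of_nonneg) simp
      also have "\<dots> \<le> \<delta> / 16 * (2 * real N)" using kN \<delta> by (intro mult_left_mono) auto
      finally show ?thesis by simp
    qed
    have "\<bar>number_variance x N S \<alpha> - real N * S\<bar> \<le> 2 * (\<delta> / 8 * real N + 2 * (real N * \<sigma>)) * S"
      using S S\<sigma> \<sigma> N1 Nk disc
      by (intro number_variance_deviation_le pair_count_deviation_le[where k = k] x irr) auto
    also have "\<dots> \<le> \<delta> * real N * S"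
    proof (intro mult_right_mono)
      have "real N * \<sigma> \<le> real N * (\<delta> / 16)" using \<sigma> by (intro mult_left_mono) auto
      moreover have "0 \<le> real N * \<delta>" using \<delta> by simp
      ultimately show "2 * (\<delta> / 8 * real N + 2 * (real N * \<sigma>)) \<le> \<delta> * real N"
        by (simp add: algebra_simps)
    qed (use S in auto)
    finally show "\<bar>number_variance x N S \<alpha> - real N * S\<bar> \<le> \<delta> * (real N * S)" by (simp add: mult.assoc)
  qed
qed

lemma SUP_ratio_tendsto_0:
  fixes f :: "nat \<Rightarrow> real \<Rightarrow> real" and r :: "nat \<Rightarrow> real"
  assumes "\<And>\<delta>. \<delta> > 0 \<Longrightarrow> \<forall>\<^sub>F N in sequentially. \<forall>S. 0 \<le> S \<and> S \<le> r N \<longrightarrow> \<bar>f N S\<bar> \<le> \<delta> * (real N * S)"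
    and "\<And>N. N \<ge> 1 \<Longrightarrow> r N > 0"
  shows "(\<lambda>N. SUP S\<in>{0<..r N}. ereal (\<bar>f N S\<bar> / (real N * S))) \<longlonglongrightarrow> 0"
proof (rule order_tendstoI)
  fix a :: ereal assume "a < 0"
  show "\<forall>\<^sub>F N in sequentially. a < (SUP S\<in>{0<..r N}. ereal (\<bar>f N S\<bar> / (real N * S)))"
  \<comment> \<open>For positive N the index set is nonempty; over an empty set the supremum in
    \<open>ereal\<close> would be minus infinity.\<close>
  proof (rule eventually_sequentiallyI[of 1])
    fix N :: nat assume N: "1 \<le> N"
    have "0 \<le> ereal (\<bar>f N (r N)\<bar> / (real N * r N))" using assms(2)[OF N] by simp
    also have "\<dots> \<le> (SUP S\<in>{0<..r N}. ereal (\<bar>f N S\<bar> / (real N * S)))"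
      using assms(2)[OF N] by (intro SUP_upper) auto
    finally show "a < (SUP S\<in>{0<..r N}. ereal (\<bar>f N S\<bar> / (real N * S)))" using \<open>a < 0\<close> by simp
  qed
next
  fix a :: ereal assume "0 < a"
  then obtain \<delta> where \<delta>: "0 < ereal \<delta>" "ereal \<delta> < a" using ereal_dense2 by blast
  then have "\<forall>\<^sub>F N in sequentially. \<forall>S. 0 \<le> S \<and> S \<le> r N \<longrightarrow> \<bar>f N S\<bar> \<le> \<delta> * (real N * S)"
    by (intro assms(1)) simp
  moreover have "\<forall>\<^sub>F N in sequentially. 1 \<le> N" by (rule eventually_ge_at_top)
  ultimately show "\<forall>\<^sub>F N in sequentially. (SUP S\<in>{0<..r N}. ereal (\<bar>f N S\<bar> / (real N * S))) < a"
  proof eventually_elim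
    case (elim N)
    have "(SUP S\<in>{0<..r N}. ereal (\<bar>f N S\<bar> / (real N * S))) \<le> ereal \<delta>"
    proof (rule SUP_least)
      fix S assume S: "S \<in> {0<..r N}"
      then have "\<bar>f N S\<bar> \<le> \<delta> * (real N * S)" using elim by auto
      then have "\<bar>f N S\<bar> / (real N * S) \<le> \<delta>" using S elim by (subst pos_divide_le_eq) auto
      then show "ereal (\<bar>f N S\<bar> / (real N * S)) \<le> ereal \<delta>" by simp
    qed
    then show ?case using \<delta> by simp
  qed
qed

text \<open>Exponents of 2 per unit of k: \<open>- \<eta> - \<epsilon>\<close> from the width,
  \<open>2 + \<eta>\<close> from the energy, \<open>\<epsilon> / 2\<close> from
  \<open>(4 ^ k) powr (\<epsilon> / 4)\<close> and \<open>- 2\<close> from the normalisation. They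
  leave \<open>- \<epsilon> / 2\<close>, which beats the polynomial factors.\<close>

lemma summable_integral_chaining_bound:
  fixes x :: "nat \<Rightarrow> int" and \<epsilon> \<eta> :: real
  assumes \<epsilon>: "\<epsilon> > 0" and x: "inj_on x {1..}" and \<eta>: "\<eta> > 0"
    and energy: "(\<lambda>N. real (additive_energy x N)) \<in> O(\<lambda>N. real N powr (2 + \<eta>))"
  shows "summable (\<lambda>k. \<integral>\<alpha>. chaining_bound x (\<eta> + \<epsilon>) k \<alpha> \<partial>circle)"
proof (rule integral_chaining_sum_le[of "\<epsilon> / 4"])
  define \<beta> where "\<beta> = \<eta> + \<epsilon>"
  fix C :: real assume C: "C > 0"
    "\<And>x \<sigma> k. inj_on x {1..} \<Longrightarrow> 0 \<le> \<sigma> \<Longrightarrow> \<sigma> \<le> 1 \<Longrightarrow>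
      (\<integral>\<alpha>. chaining_sum x (\<sigma> / 4 ^ k) k \<alpha> \<partial>circle)
        \<le> C * (real k + 1) * (real (2 * k) + 1) * \<sigma> * (4 ^ k) powr (\<epsilon> / 4) * real (additive_energy x (2 ^ k))"
  obtain c where c: "c > 0" "\<forall>\<^sub>F N in sequentially. norm (real (additive_energy x N)) \<le> c * norm (real N powr (2 + \<eta>))"
    using energy by (elim landau_o.bigE)
  then obtain N0 where N0: "\<And>N. N \<ge> N0 \<Longrightarrow> real (additive_energy x N) \<le> c * real N powr (2 + \<eta>)"
    unfolding eventually_sequentially by auto
  \<comment> \<open>The level count enters squared, once from the pointwise chaining inequality and
    once from the integral of the chaining sum; \<open>2 powr \<beta>\<close> comes from the
    \<open>k - 1\<close> in \<open>width\<close>.\<close>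
  define B where "B = (\<lambda>k. C * c * 2 powr \<beta> * (((real k + 1) * (2 * real k + 1))\<^sup>2 * 2 powr (- (\<epsilon> / 2) * real k)))"
  have "summable (\<lambda>k. ((real k + 1) * (2 * real k + 1))\<^sup>2 * 2 powr (- (\<epsilon> / 2) * real k))"
  proof (rule summable_comparison_test_bigo)
    show "summable (\<lambda>k. norm (1 / (real k)\<^sup>2))"
      using inverse_power_summable[of 2, where 'a = real] by (simp add: inverse_eq_divide)
    show "(\<lambda>k. ((real k + 1) * (2 * real k + 1))\<^sup>2 * 2 powr (- (\<epsilon> / 2) * real k)) \<in> O(\<lambda>k. 1 / (real k)\<^sup>2)"
      using \<epsilon> by real_asymp
  qed
  then have B: "summable B" unfolding B_def by (rule summable_mult)
  \<comment> \<open>At \<open>k = 0\<close> the width exceeds 1, so the second moment bound starts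
    at 1; \<open>k \<ge> N0\<close> puts \<open>2 ^ k\<close> into the range of the energy
    hypothesis.\<close>
  have le: "(\<integral>\<alpha>. chaining_bound x \<beta> k \<alpha> \<partial>circle) \<le> B k" if k: "k \<ge> max 1 N0" for k
  proof -
    define q where "q = (real k + 1) * (real (2 * k) + 1)"
    define \<sigma> where "\<sigma> = width \<beta> k"
    have q: "q \<ge> 0" by (simp add: q_def)
    have "N0 \<le> 2 ^ k" using k less_exp[of k] by linarith
    then have E: "real (additive_energy x (2 ^ k)) \<le> c * (2 ^ k) powr (2 + \<eta>)"
      using N0[of "2 ^ k"] by simp
    have "\<beta> * (real k - 1) \<ge> 0" using k \<epsilon> \<eta> by (simp add: \<beta>_def)
    then have \<sigma>: "0 \<le> \<sigma>" "\<sigma> \<le> 1" using powr_mono[of "- \<beta> * (real k - 1)" 0 2] by (auto simp: \<sigma>_def width_def)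
    have "(\<integral>\<alpha>. chaining_bound x \<beta> k \<alpha> \<partial>circle) = q * (\<integral>\<alpha>. chaining_sum x (\<sigma> / 4 ^ k) k \<alpha> \<partial>circle) / 4 ^ k"
      by (simp add: chaining_bound_def q_def \<sigma>_def)
    also have "\<dots> \<le> q * (C * q * \<sigma> * (4 ^ k) powr (\<epsilon> / 4) * real (additive_energy x (2 ^ k))) / 4 ^ k"
      using C(2)[OF x \<sigma>, of k] q by (intro divide_right_mono mult_left_mono) (auto simp: q_def mult.assoc)
    also have "\<dots> \<le> q * (C * q * \<sigma> * (4 ^ k) powr (\<epsilon> / 4) * (c * (2 ^ k) powr (2 + \<eta>))) / 4 ^ k"
      using C q \<sigma> E by (intro divide_right_mono mult_left_mono) auto
    also have "\<dots> = C * c * q\<^sup>2 * (\<sigma> * (4 ^ k) powr (\<epsilon> / 4) * (2 ^ k) powr (2 + \<eta>) / 4 ^ k)"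
      by (simp add: power2_eq_square)
    also have "\<sigma> * (4 ^ k) powr (\<epsilon> / 4) * (2 ^ k) powr (2 + \<eta>) / 4 ^ k = 2 powr \<beta> * 2 powr (- (\<epsilon> / 2) * real k)"
    proof -
      have 2: "(2::real) ^ k = 2 powr real k" by (simp add: powr_realpow)
      have 4: "(4::real) ^ k = 2 powr (2 * real k)"
        by (simp add: powr_realpow[symmetric] powr_powr[symmetric])
      show ?thesis
        unfolding 2 4 \<sigma>_def width_def powr_powr powr_add[symmetric] powr_diff[symmetric]
        by (rule arg_cong[where f = "\<lambda>z. 2 powr z"]) (simp add: \<beta>_def algebra_simps)
    qed
    also have "C * c * q\<^sup>2 * \<dots> = B k" by (simp add: B_def q_def)
    finally show ?thesis .
  qed
  show "summable (\<lambda>k. \<integral>\<alpha>. chaining_bound x (\<eta> + \<epsilon>) k \<alpha> \<partial>circle)"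
    unfolding \<beta>_def[symmetric]
  proof (rule summable_comparison_test[OF _ B], intro exI[of _ "max 1 N0"] allI impI)
    fix k assume k: "max 1 N0 \<le> k"
    have "(\<integral>\<alpha>. chaining_bound x \<beta> k \<alpha> \<partial>circle) \<ge> 0"
      by (intro integral_nonneg_AE AE_I2) (simp add: chaining_bound_def chaining_sum_nonneg)
    then show "norm (\<integral>\<alpha>. chaining_bound x \<beta> k \<alpha> \<partial>circle) \<le> B k" using le[OF k] by simp
  qed
qed (use \<epsilon> in simp)

theorem theorem2:
  fixes x :: "nat \<Rightarrow> int" and \<epsilon> \<eta> :: real
  assumes "\<epsilon> > 0"
    and "inj_on x {1..}"
    and "\<And>n. n \<ge> 1 \<Longrightarrow> x n > 0"
    and "\<eta> > 0"
    and "(\<lambda>N. real (additive_energy x N)) \<in> O(\<lambda>N. real N powr (2 + \<eta>))"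
  shows "AE \<alpha>\<in>{0..1} in lebesgue.
     (\<forall>\<delta>>0. \<forall>\<^sub>F N in sequentially. \<forall>S. 0 \<le> S \<and> S \<le> real N powr (- \<eta> - \<epsilon>) \<longrightarrow>
        \<bar>number_variance x N S \<alpha> - real N * S\<bar> \<le> \<delta> * (real N * S)) \<and>
     ((\<lambda>N. SUP S\<in>{0<..real N powr (- \<eta> - \<epsilon>)}.
        ereal (\<bar>number_variance x N S \<alpha> - real N * S\<bar> / (real N * S))) \<longlonglongrightarrow> 0)"
proof -
  define \<beta> where "\<beta> = \<eta> + \<epsilon>"
  have \<beta>: "\<beta> > 0" "- \<eta> - \<epsilon> = - \<beta>" using assms by (auto simp: \<beta>_def)
  have "AE \<alpha> in circle. (\<lambda>k. chaining_bound x \<beta> k \<alpha>) \<longlonglongrightarrow> 0"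
  proof (rule AE_tendsto_0_of_summable_integrals)
    show "integrable circle (chaining_bound x \<beta> k)" for k
      unfolding chaining_bound_def[abs_def] using integrable_chaining_sum by simp
    show "summable (\<lambda>k. \<integral>\<alpha>. chaining_bound x \<beta> k \<alpha> \<partial>circle)"
      unfolding \<beta>_def by (rule summable_integral_chaining_bound[OF assms(1,2,4,5)])
  qed (simp add: chaining_bound_def chaining_sum_nonneg)
  then have "AE \<alpha> in lborel. \<alpha> \<in> {0..<1} \<longrightarrow> (\<lambda>k. chaining_bound x \<beta> k \<alpha>) \<longlonglongrightarrow> 0"
    unfolding circle_def by (subst (asm) AE_restrict_space_iff) auto
  \<comment> \<open>Irrationality keeps every product of \<alpha> with a nonzero difference away
    from the integers, as the overlap formula requires.\<close>
  moreover have "AE \<alpha> in lborel. \<alpha> \<notin> (\<rat> :: real set)"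
    by (intro AE_not_in countable_imp_null_set_lborel countable_rat)
  \<comment> \<open>The right endpoint is missing from \<open>circle\<close>.\<close>
  moreover have "AE \<alpha> in lborel. \<alpha> \<noteq> (1::real)" by (rule AE_lborel_singleton)
  ultimately have "AE \<alpha>\<in>{0..1} in lborel. \<alpha> \<notin> \<rat> \<and> (\<lambda>k. chaining_bound x \<beta> k \<alpha>) \<longlonglongrightarrow> 0"
    by eventually_elim auto
  then have "AE \<alpha>\<in>{0..1} in lebesgue. \<alpha> \<notin> \<rat> \<and> (\<lambda>k. chaining_bound x \<beta> k \<alpha>) \<longlonglongrightarrow> 0"
    by (rule AE_completion)
  then show ?thesis
    unfolding \<beta>(2)
  proof eventually_elim
    case (elim \<alpha>)
    show ?case
    proof (intro impI conjI allI)
      assume "\<alpha> \<in> {0..1}"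
      with elim have \<alpha>: "\<alpha> \<notin> \<rat>" "(\<lambda>k. chaining_bound x \<beta> k \<alpha>) \<longlonglongrightarrow> 0" by auto
      note unif = number_variance_uniform[OF assms(2) \<alpha>(1) \<beta>(1) \<alpha>(2)]
      show "\<forall>\<^sub>F N in sequentially. \<forall>S. 0 \<le> S \<and> S \<le> real N powr (- \<beta>) \<longrightarrow>
          \<bar>number_variance x N S \<alpha> - real N * S\<bar> \<le> \<delta> * (real N * S)" if "\<delta> > 0" for \<delta>
        by (rule unif[OF that])
      show "(\<lambda>N. SUP S\<in>{0<..real N powr (- \<beta>)}.
          ereal (\<bar>number_variance x N S \<alpha> - real N * S\<bar> / (real N * S))) \<longlonglongrightarrow> 0"
        by (rule SUP_ratio_tendsto_0[OF unif]) auto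
    qed
  qed
qed

end
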